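(* Let $n\ge1$ and let $q:\mathbb R^{2n}\to\mathbb C$ be a complex-valued quadratic form with nonnegative real part $\operatorname{Re} q\ge0$. Let $F$ be the Hamilton map of $q$, $S$ its singular space, and $0\le k_0\le 2n-1$ the smallest integer such that $S=\bigcap_{j=0}^{k_0}\ker(\operatorname{Re}F(\operatorname{Im}F)^j)\cap\mathbb R^{2n}$. Let $(a_t)_{t\in\mathbb R}$ be the family of nonnegative quadratic forms on $\mathbb R^{2n}$, depending analytically on $t$, that provides the selfadjoint part of the polar decomposition $e^{-tq^w}=e^{-ta_t^w}U_t$, $t\ge0$, with $U_t$ metaplectic (see the context for the explicit description of $a_t$). Then there exist constants $0<T<1$ and $c>0$ such that for all $0\le t\le T$ and $X\in\mathbb R^{2n}$, $$a_t(X)\ge c\sum_{j=0}^{k_0}t^{2j}\,\operatorname{Re} q\big((\operatorname{Im}F)^jX\big).$$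
   Context: Let $Q\in S_{2n}(\mathbb C)$ be the symmetric matrix of $q$ ($q(X)=X^TQX$) and $J=\begin{pmatrix}0_n&I_n\\-I_n&0_n\end{pmatrix}$. The Hamilton map of $q$ is $F=JQ$; $\operatorname{Re}F=J\operatorname{Re}Q$ and $\operatorname{Im}F=J\operatorname{Im}Q$ are the entrywise real and imaginary parts. The singular space of $q$ is $S=\bigcap_{j=0}^{+\infty}\ker(\operatorname{Re}F(\operatorname{Im}F)^j)\cap\mathbb R^{2n}$ (by Cayley–Hamilton the intersection over $0\le j\le 2n-1$ already equals $S$). Explicit description of $a_t$: for every $t\in\mathbb R$ all eigenvalues of $e^{-2itJQ}e^{-2itJ\overline Q}$ are positive real numbers; with $\operatorname{Log}$ the principal logarithm on $\mathbb C\setminus\mathbb R_-$ applied through the holomorphic functional calculus, the function $t\mapsto\operatorname{Log}(e^{-2itJQ}e^{-2itJ\overline Q})$ is real-analytic on $\mathbb R$ and vanishes at $t=0$. One sets $$A_t=-(4itJ)^{-1}\operatorname{Log}\big(e^{-2itJQ}e^{-2itJ\overline Q}\big),$$ (the value at $t=0$ being given by analytic extension); $A_t$ is a real symmetric positive semidefinite matrix, analytic in $t$, and $a_t(X)=X^TA_tX$ for $X\in\mathbb R^{2n}$. Here $q^w$ denotes the Weyl quantization $\begin{pmatrix}x&-i\nabla\end{pmatrix}Q\begin{pmatrix}x\\-i\nabla\end{pmatrix}$, $(e^{-tq^w})_{t\ge 0}$ the contraction semigroup on $L^2(\mathbb R^n)$ with generator $-q^w$, and $e^{-ta_t^w}=e^{-sa_t^w}|_{s=t}$.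 In the sum, $t^{0}=1$ (also at $t=0$). *)

theory Defs
  imports "HOL-Complex_Analysis.Complex_Analysis"
begin

text \<open>Phase space of dimension \<open>2n\<close> is indexed by the type \<^typ>\<open>'n + 'n\<close>, where
  \<open>n\<close> is the cardinality of \<open>'n\<close>: \<^const>\<open>Inl\<close> indexes the positions and \<^const>\<open>Inr\<close>
  the momenta. On \<^typ>\<open>'a^'n^'n\<close> the library operations \<open>*\<close> and \<open>^\<close> are not those of the
  matrix algebra, hence the separate power and exponential below.\<close>

primrec matrix_pow :: "'a::semiring_1^'n::finite^'n \<Rightarrow> nat \<Rightarrow> 'a^'n^'n" where
  "matrix_pow A 0 = mat 1"
| "matrix_pow A (Suc k) = A ** matrix_pow A k"

definition matrix_exp :: "complex^'n::finite^'n \<Rightarrow> complex^'n^'n" where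
  "matrix_exp A = (\<Sum>k. (1 / fact k) *\<^sub>R matrix_pow A k)"

definition matrix_spectrum :: "complex^'n::finite^'n \<Rightarrow> complex set" where
  "matrix_spectrum M = {z. \<not> invertible (mat z - M)}"

text \<open>Principal logarithm by the holomorphic functional calculus,
  \<open>Log M = (2\<pi>i)\<^sup>-\<^sup>1 \<integral>\<^sub>\<gamma> Log z (z - M)\<^sup>-\<^sup>1 dz\<close>, where \<open>\<gamma>\<close> is a closed path in the slit plane
  winding once around each eigenvalue of \<open>M\<close>. Such a path exists if and only if \<open>M\<close> has no
  eigenvalue on the nonpositive real axis, and by Cauchy's theorem the integral does not
  depend on its choice.\<close>

definition Ln_contour :: "complex^'n::finite^'n \<Rightarrow> (real \<Rightarrow> complex) \<Rightarrow> bool" where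
  "Ln_contour M \<gamma> \<longleftrightarrow>
     valid_path \<gamma> \<and> pathfinish \<gamma> = pathstart \<gamma> \<and>
     path_image \<gamma> \<inter> (\<real>\<^sub>\<le>\<^sub>0 \<union> matrix_spectrum M) = {} \<and>
     (\<forall>z\<in>matrix_spectrum M. winding_number \<gamma> z = 1) \<and>
     (\<forall>z\<in>\<real>\<^sub>\<le>\<^sub>0. winding_number \<gamma> z = 0)"

definition matrix_Ln :: "complex^'n::finite^'n \<Rightarrow> complex^'n^'n" where
  "matrix_Ln M =
     (let \<gamma> = (SOME \<gamma>. Ln_contour M \<gamma>)
      in \<chi> i j. 1 / (2 * of_real pi * \<i>) *
           contour_integral \<gamma> (\<lambda>z. Ln z * matrix_inv (mat z - M) $ i $ j))"

definition symplectic_J :: "'a::ring_1^('n::finite + 'n)^('n + 'n)" where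
  "symplectic_J = (\<chi> i j.
     (case (i, j) of
        (Inl a, Inr b) \<Rightarrow> if a = b then 1 else 0
      | (Inr a, Inl b) \<Rightarrow> if a = b then - 1 else 0
      | _ \<Rightarrow> 0))"

definition complex_vec :: "real^'n::finite \<Rightarrow> complex^'n" where
  "complex_vec X = (\<chi> i. complex_of_real (X $ i))"

definition quad_form :: "complex^'n::finite^'n \<Rightarrow> real^'n \<Rightarrow> complex" where
  "quad_form Q X = scalar_product (complex_vec X) (Q *v complex_vec X)"

definition symmetric_matrix_of ::
  "complex^'n::finite^'n \<Rightarrow> (real^'n \<Rightarrow> complex) \<Rightarrow> bool" where
  "symmetric_matrix_of Q q \<longleftrightarrow> transpose Q = Q \<and> (\<forall>X. q X = quad_form Q X)"

definition hamilton_map ::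
  "complex^('n::finite + 'n)^('n + 'n) \<Rightarrow> complex^('n + 'n)^('n + 'n)" where
  "hamilton_map Q = symplectic_J ** Q"

abbreviation Re_matrix :: "complex^'n::finite^'n \<Rightarrow> real^'n^'n" where
  "Re_matrix \<equiv> map_matrix Re"

abbreviation Im_matrix :: "complex^'n::finite^'n \<Rightarrow> real^'n^'n" where
  "Im_matrix \<equiv> map_matrix Im"

text \<open>As \<open>Re F (Im F)\<^sup>j\<close> is a real matrix, its kernel intersected with the real phase space is
  its kernel as a real matrix.\<close>

definition hamilton_kernel ::
  "complex^('n::finite + 'n)^('n + 'n) \<Rightarrow> nat \<Rightarrow> (real^('n + 'n)) set" where
  "hamilton_kernel F j = {X. (Re_matrix F ** matrix_pow (Im_matrix F) j) *v X = 0}"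

definition singular_space ::
  "complex^('n::finite + 'n)^('n + 'n) \<Rightarrow> (real^('n + 'n)) set" where
  "singular_space F = (\<Inter>j. hamilton_kernel F j)"

definition polar_product ::
  "complex^('n::finite + 'n)^('n + 'n) \<Rightarrow> real \<Rightarrow> complex^('n + 'n)^('n + 'n)" where
  "polar_product Q t =
     matrix_exp (mat (- 2 * \<i> * of_real t) ** symplectic_J ** Q) **
     matrix_exp (mat (- 2 * \<i> * of_real t) ** symplectic_J ** map_matrix cnj Q)"

definition polar_matrix_nz ::
  "complex^('n::finite + 'n)^('n + 'n) \<Rightarrow> real \<Rightarrow> complex^('n + 'n)^('n + 'n)" where
  "polar_matrix_nz Q t =
     - (matrix_inv (mat (4 * \<i> * of_real t) ** symplectic_J) ** matrix_Ln (polar_product Q t))"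

text \<open>The formula for \<open>A\<^sub>t\<close> has a removable singularity at \<open>t = 0\<close>; the value there of its
  analytic extension is the limit.\<close>

definition polar_matrix ::
  "complex^('n::finite + 'n)^('n + 'n) \<Rightarrow> real \<Rightarrow> complex^('n + 'n)^('n + 'n)" where
  "polar_matrix Q t = (if t = 0 then Lim (at 0) (polar_matrix_nz Q) else polar_matrix_nz Q t)"

text \<open>For symmetric \<open>Q\<close> with positive semidefinite real part the entries of \<open>A\<^sub>t\<close> are real, so
  \<^const>\<open>Re\<close> serves only to view the value \<open>X\<^sup>T A\<^sub>t X\<close> as an element of \<^typ>\<open>real\<close>.\<close>

definition polar_form ::
  "complex^('n::finite + 'n)^('n + 'n) \<Rightarrow> real \<Rightarrow> real^('n + 'n) \<Rightarrow> real" where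
  "polar_form Q t X = Re (quad_form (polar_matrix Q t) X)"

end

theory Submission
  imports Defs
begin

text \<open>
  Write \<open>R = Re Q\<close>, \<open>B = Im F = J Im Q\<close> and split the flow into real matrices,
  \<open>exp(-2itJQ) = U + iV\<close>. The second factor of \<open>P = exp(-2itJQ) exp(-2itJQ\<^sup>*)\<close>, where \<open>Q\<^sup>*\<close> is the entrywise
  conjugate, is the inverse of \<open>U - iV\<close>, so for small \<open>t\<close> the Cayley transform of \<open>P\<close> is
  \<open>(P - 1)(P + 1)\<^sup>-\<^sup>1 = iD\<close> with the real matrix \<open>D = V U\<^sup>-\<^sup>1\<close>, and \<open>Log P = 2 artanh (iD)\<close>
  (lemmas \<open>polar_product_cayley\<close> and \<open>matrix_Ln_sums\<close>).

  The matrix \<open>C = J D\<close> is symmetric, which makes \<open>D\<close> skew for the symplectic form. Hence every term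
  of the series of \<open>A\<^sub>t\<close> is a multiple of a value of \<open>C\<close>,
  \<open>a\<^sub>t(X) = (2t)\<^sup>-\<^sup>1 \<Sum>\<^sub>m C(D\<^sup>m X) / (2m + 1)\<close>, and as \<open>C\<close> turns out to be nonnegative, the first term
  alone gives \<open>a\<^sub>t(X) \<ge> C(X) / (2t)\<close> (lemma \<open>polar_form_ge_flow_energy\<close>).

  The form \<open>C\<close> is an energy. With \<open>x\<close> and \<open>y\<close> the real and imaginary parts of the trajectory of
  the flow for which \<open>x(t) = X\<close> and \<open>y(0) = 0\<close>, differentiating \<open>x \<bullet> J y\<close> shows
  \<open>C(X) = 2 \<integral>\<^sub>0\<^sup>t R(x) + R(y)\<close> (lemma \<open>flow_energy_integral\<close>). Backwards in time, \<open>x\<close> solves the linear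
  equation with matrix \<open>-2B\<close> and with a perturbation that depends only on \<open>R y\<close>, and hence is bounded by
  the energy itself.

  It remains to bound the energy from below (lemma \<open>perturbed_flow_lower_bound\<close>). The unperturbed
  solution is compared with its Taylor polynomial of degree \<open>k\<^sub>0\<close>, whose coefficients are
  multiples of \<open>B\<^sup>j X\<close>; the integral of \<open>R\<close> along a polynomial curve dominates all its coefficients
  (lemma \<open>qf_polynomial_lower_bound\<close>), each with the power \<open>t\<^sup>2\<^sup>j\<^sup>+\<^sup>1\<close>. The distance between \<open>x\<close> and
  the polynomial is measured by \<open>N(X) = \<Sum>\<^sub>j R(B\<^sup>j X)\<close>, \<open>j \<le> k\<^sub>0\<close>. By the hypothesis on \<open>k\<^sub>0\<close> the kernel of
  \<open>N\<close> is the singular space, which is invariant under \<open>B\<close>, so that \<open>N(B\<^sup>m X)\<close> is bounded by a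
  multiple of \<open>N(X)\<close> and Gronwall's argument closes within \<open>N\<close>: the error is smaller by a factor \<open>t\<close>
  than the terms to be compared. The bound at \<open>t = 0\<close> follows by passage to the limit.
\<close>


section \<open>Matrices as a normed algebra\<close>

lemma norm_transpose_matrix:
  fixes A :: "'a::real_normed_vector^'n::finite^'m::finite"
  shows "norm (transpose A) = norm A"
proof -
  have "(\<Sum>i\<in>UNIV. \<Sum>j\<in>UNIV. (norm (A $ j $ i))\<^sup>2) = (\<Sum>j\<in>UNIV. \<Sum>i\<in>UNIV. (norm (A $ j $ i))\<^sup>2)"
    by (rule sum.swap)
  then show ?thesis
    by (simp add: norm_vec_def L2_set_def sum_nonneg transpose_def)
qed

lemma norm_matrix_nth_le:
  fixes A :: "'a::real_normed_vector^'n::finite^'m::finite"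
  shows "norm (A $ i $ j) \<le> norm A"
  by (rule order_trans[OF Finite_Cartesian_Product.norm_nth_le Finite_Cartesian_Product.norm_nth_le])

lemma norm_matrix_vector_mult_le:
  fixes A :: "'a::real_normed_field^'n::finite^'m::finite"
  shows "norm (A *v x) \<le> norm A * norm x"
proof -
  have row: "norm ((A *v x) $ i) \<le> norm (A $ i) * norm x" for i
  proof -
    have "norm ((A *v x) $ i) \<le> (\<Sum>j\<in>UNIV. norm (A $ i $ j) * norm (x $ j))"
      unfolding matrix_vector_mult_def by (simp add: sum_norm_le norm_mult)
    also have "\<dots> \<le> norm (A $ i) * norm x"
      using L2_set_mult_ineq[of "\<lambda>j. norm (A $ i $ j)" "\<lambda>j. norm (x $ j)" UNIV]
      by (simp add: norm_vec_def)
    finally show ?thesis .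
  qed
  have "norm (A *v x) \<le> L2_set (\<lambda>i. norm (A $ i) * norm x) UNIV"
    unfolding norm_vec_def[of "A *v x"] by (rule L2_set_mono) (auto simp: row)
  also have "\<dots> = norm A * norm x"
    by (simp add: norm_vec_def[of A] L2_set_left_distrib)
  finally show ?thesis .
qed

lemma norm_matrix_mult_le:
  fixes A :: "'a::real_normed_field^'n::finite^'m::finite" and B :: "'a^'k::finite^'n"
  shows "norm (A ** B) \<le> norm A * norm B"
proof -
  have row: "norm ((A ** B) $ i) \<le> norm (A $ i) * norm B" for i
  proof -
    have "(A ** B) $ i = transpose B *v (A $ i)"
      by (simp add: vec_eq_iff matrix_matrix_mult_def transpose_def matrix_vector_mult_def mult.commute
          del: transpose_matrix_vector)
    then show ?thesis
      using norm_matrix_vector_mult_le[of "transpose B" "A $ i"]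
      by (simp add: norm_transpose_matrix mult.commute del: transpose_matrix_vector)
  qed
  have "norm (A ** B) \<le> L2_set (\<lambda>i. norm (A $ i) * norm B) UNIV"
    unfolding norm_vec_def[of "A ** B"] by (rule L2_set_mono) (auto simp: row)
  also have "\<dots> = norm A * norm B"
    by (simp add: norm_vec_def[of A] L2_set_left_distrib)
  finally show ?thesis .
qed

lemma scaleR_mult_matrix:
  fixes A :: "'a::real_normed_field^'n::finite^'m::finite" and B :: "'a^'k::finite^'n"
  shows "(r *\<^sub>R A) ** B = r *\<^sub>R (A ** B)" "A ** (r *\<^sub>R B) = r *\<^sub>R (A ** B)"
    "(r *\<^sub>R A) *v x = r *\<^sub>R (A *v x)" "A *v (r *\<^sub>R x) = r *\<^sub>R (A *v x)"
  by (simp_all add: vec_eq_iff matrix_matrix_mult_def matrix_vector_mult_def scaleR_sum_right)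

lemma bounded_bilinear_matrix_mult:
  "bounded_bilinear (\<lambda>(A::'a::real_normed_field^'n::finite^'m::finite) (B::'a^'k::finite^'n). A ** B)"
proof
  show "\<exists>K. \<forall>(A::'a^'n^'m) (B::'a^'k^'n). norm (A ** B) \<le> norm A * norm B * K"
    by (intro exI[of _ 1]) (simp add: norm_matrix_mult_le)
qed (simp_all only: scaleR_mult_matrix,
    simp_all add: vec_eq_iff matrix_matrix_mult_def algebra_simps sum.distrib)

lemma bounded_bilinear_matrix_vector_mult:
  "bounded_bilinear (\<lambda>(A::'a::real_normed_field^'n::finite^'m::finite) x. A *v x)"
proof
  show "\<exists>K. \<forall>(A::'a^'n^'m) x. norm (A *v x) \<le> norm A * norm x * K"
    by (intro exI[of _ 1]) (simp add: norm_matrix_vector_mult_le)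
qed (simp_all only: scaleR_mult_matrix,
    simp_all add: vec_eq_iff matrix_vector_mult_def algebra_simps sum.distrib)

interpretation mm: bounded_bilinear
  "\<lambda>(A::'a::real_normed_field^'n::finite^'m::finite) (B::'a^'k::finite^'n). A ** B"
  by (rule bounded_bilinear_matrix_mult)

interpretation mv: bounded_bilinear
  "\<lambda>(A::'a::real_normed_field^'n::finite^'m::finite) x. A *v x"
  by (rule bounded_bilinear_matrix_vector_mult)

lemma mat_mult_nth:
  fixes A :: "'a::comm_semiring_1^'n::finite^'n"
  shows "(mat z ** A) $ i $ j = z * A $ i $ j" "(A ** mat z) $ i $ j = z * A $ i $ j"
  by (simp_all add: matrix_matrix_mult_def mat_def if_distrib if_distribR mult.commute[of _ z]
      cong: if_cong)

lemma mat_commute: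
  fixes A :: "'a::comm_semiring_1^'n::finite^'n"
  shows "mat z ** A = A ** mat z"
  by (simp add: vec_eq_iff mat_mult_nth)

lemma mat_mult_mat: "mat a ** mat b = (mat (a * b) :: 'a::comm_semiring_1^'n::finite^'n)"
  by (simp add: vec_eq_iff mat_mult_nth(1)) (simp add: mat_def)

lemma mat_vector_mult:
  fixes x :: "'a::comm_semiring_1^'n::finite"
  shows "mat z *v x = z *s x"
  by (simp add: vec_eq_iff matrix_vector_mult_def mat_def if_distrib if_distribR sum.delta sum.delta' cong: if_cong)

lemma norm_matrix_pow_le:
  fixes A :: "'a::real_normed_field^'n::finite^'n"
  shows "norm (matrix_pow A k) \<le> norm (mat 1 :: 'a^'n^'n) * norm A ^ k"
proof (induction k)
  case (Suc k)
  have "norm (matrix_pow A (Suc k)) \<le> norm A * norm (matrix_pow A k)"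
    by (simp add: norm_matrix_mult_le)
  also have "\<dots> \<le> norm A * (norm (mat 1 :: 'a^'n^'n) * norm A ^ k)"
    by (intro mult_left_mono Suc) simp
  finally show ?case by (simp add: mult_ac)
qed simp

lemma matrix_pow_commute:
  "matrix_pow A k ** A = A ** matrix_pow A k"
  by (induction k) (simp_all add: matrix_mul_assoc[symmetric])

lemma matrix_pow_add: "matrix_pow A (j + k) = matrix_pow A j ** matrix_pow A k"
  by (induction j) (simp_all add: matrix_mul_assoc)

lemma matrix_pow_mat_mult:
  fixes A :: "'a::comm_semiring_1^'n::finite^'n"
  shows "matrix_pow (mat z ** A) k = mat (z ^ k) ** matrix_pow A k"
proof (induction k)
  case (Suc k)
  have "matrix_pow (mat z ** A) (Suc k) = mat z ** (A ** mat (z ^ k)) ** matrix_pow A k"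
    by (simp add: Suc matrix_mul_assoc)
  also have "\<dots> = mat z ** mat (z ^ k) ** (A ** matrix_pow A k)"
    by (simp add: mat_commute[of _ A, symmetric] matrix_mul_assoc)
  finally show ?case by (simp add: mat_mult_mat)
qed simp

lemma matrix_pow_scaleR_mult:
  fixes A :: "real^'n::finite^'n"
  shows "matrix_pow (r *\<^sub>R A) j *v x = r ^ j *\<^sub>R (matrix_pow A j *v x)"
  by (induction j) (simp_all add: matrix_vector_mul_assoc[symmetric] mv.scaleR_left mv.scaleR_right)

text \<open>A kernel vector \<open>x\<close> would satisfy \<open>z x = A x\<close>, which the norms forbid.\<close>

lemma invertible_near_mat:
  fixes A :: "'a::real_normed_field^'n::finite^'n"
  assumes "norm A < norm z"
  shows "invertible (mat z - A)"
proof -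
  have "x = 0" if "(mat z - A) *v x = 0" for x
  proof (rule ccontr)
    assume "x \<noteq> 0"
    have nz: "norm (z *s x) = norm z * norm x"
      by (simp add: norm_vec_def norm_mult L2_set_right_distrib)
    have "z *s x = A *v x"
      using that by (simp add: algebra_simps mat_vector_mult)
    then have "norm z * norm x \<le> norm A * norm x"
      using norm_matrix_vector_mult_le[of A x] nz by simp
    then show False using assms \<open>x \<noteq> 0\<close> by simp
  qed
  then show ?thesis
    by (metis invertible_left_inverse matrix_left_invertible_ker)
qed

lemma matrix_inv_mult:
  fixes A :: "'a::field^'n::finite^'n"
  assumes "invertible A"
  shows "A ** matrix_inv A = mat 1" "matrix_inv A ** A = mat 1"
  using assms unfolding invertible_def matrix_inv_def by (metis (mono_tags, lifting) someI_ex)+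

lemma matrix_inv_eqI:
  fixes A :: "'a::field^'n::finite^'n"
  assumes "A ** B = mat 1"
  shows "matrix_inv A = B"
proof -
  have "invertible A"
    using assms invertible_right_inverse by blast
  then show ?thesis
    by (metis assms matrix_inv_mult(2) matrix_mul_assoc matrix_mul_lid matrix_mul_rid)
qed


lemma invertible_near_1:
  fixes A :: "'a::real_normed_field^'n::finite^'n"
  assumes "norm (mat 1 - A) < 1"
  shows "invertible A"
  using invertible_near_mat[of "mat 1 - A" 1] assms by simp

lemma norm_matrix_inv_minus_1:
  fixes A :: "'a::real_normed_field^'n::finite^'n"
  assumes "norm (mat 1 - A) \<le> 1/2"
  shows "norm (matrix_inv A - mat 1) \<le> 2 * norm (mat 1 :: 'a^'n^'n) * norm (mat 1 - A)"
proof -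
  have inv: "invertible A" using assms by (intro invertible_near_1) simp
  let ?B = "matrix_inv A"
  have eq: "?B - mat 1 = (mat 1 - A) ** ?B"
    by (simp add: mm.diff_left matrix_inv_mult(1)[OF inv])
  have "mat 1 + (mat 1 - A) ** ?B = ?B"
    by (simp add: eq[symmetric])
  then have "norm ?B \<le> norm (mat 1 :: 'a^'n^'n) + norm ((mat 1 - A) ** ?B)"
    using norm_triangle_ineq[of "mat 1" "(mat 1 - A) ** ?B"] by simp
  also have "norm ((mat 1 - A) ** ?B) \<le> 1/2 * norm ?B"
    by (rule order_trans[OF norm_matrix_mult_le]) (intro mult_right_mono assms norm_ge_zero)
  finally have "norm ?B \<le> 2 * norm (mat 1 :: 'a^'n^'n)" by simp
  then have "norm (mat 1 - A) * norm ?B \<le> norm (mat 1 - A) * (2 * norm (mat 1 :: 'a^'n^'n))"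
    by (intro mult_left_mono) auto
  then show ?thesis
    unfolding eq using norm_matrix_mult_le[of "mat 1 - A" ?B] by (simp add: mult_ac)
qed

section \<open>The exponential of a matrix\<close>

lemma bounded_linear_matrix_nth: "bounded_linear (\<lambda>A::'a::real_normed_vector^'n::finite^'m::finite. A $ i $ j)"
  by (rule bounded_linear_compose[OF bounded_linear_vec_nth bounded_linear_vec_nth])

lemma matrix_exp_sums:
  fixes A :: "complex^'n::finite^'n"
  shows "(\<lambda>k. (1 / fact k) *\<^sub>R matrix_pow A k) sums matrix_exp A"
proof -
  have "summable (\<lambda>k. norm (mat 1 :: complex^'n^'n) * (inverse (fact k) * norm A ^ k))"
    by (intro summable_mult summable_exp)
  moreover have "norm ((1 / fact k) *\<^sub>R matrix_pow A k)
      \<le> norm (mat 1 :: complex^'n^'n) * (inverse (fact k) * norm A ^ k)" for k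
    using norm_matrix_pow_le[of A k] by (simp add: field_simps)
  ultimately have "summable (\<lambda>k. (1 / fact k) *\<^sub>R matrix_pow A k)"
    by (rule summable_comparison_test'[where N = 0])
  then show ?thesis
    unfolding matrix_exp_def by (rule summable_sums)
qed

lemma matrix_exp_nth_sums:
  "(\<lambda>k. (1 / fact k) * (matrix_pow A k $ i $ j)) sums (matrix_exp A $ i $ j)"
  using bounded_linear.sums[OF bounded_linear_matrix_nth matrix_exp_sums, of A i j]
  by (simp only: vector_scaleR_component) (simp add: scaleR_conv_of_real)

text \<open>Entrywise, \<open>z \<mapsto> exp (z K)\<close> is an everywhere convergent scalar power series, so it may be
  differentiated termwise.\<close>

lemma has_field_derivative_matrix_exp_nth:
  fixes K :: "complex^'n::finite^'n"
  shows "((\<lambda>z. matrix_exp (mat z ** K) $ i $ j) has_field_derivative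
    (K ** matrix_exp (mat z ** K)) $ i $ j) (at z)"
proof -
  define c where "c l k = matrix_pow K k $ l $ j / fact k" for l k
  have sums: "(\<lambda>k. c l k * y ^ k) sums (matrix_exp (mat y ** K) $ l $ j)" for l y
    using matrix_exp_nth_sums[of "mat y ** K" l j]
    by (simp add: c_def matrix_pow_mat_mult mat_mult_nth mult_ac)
  have "((\<lambda>y. \<Sum>k. c i k * y ^ k) has_field_derivative (\<Sum>k. diffs (c i) k * z ^ k)) (at z)"
    using sums by (intro termdiffs_strong_converges_everywhere) (auto simp: sums_iff)
  moreover have "(\<Sum>k. c i k * y ^ k) = matrix_exp (mat y ** K) $ i $ j" for y
    using sums by (simp add: sums_iff)
  moreover have "(\<Sum>k. diffs (c i) k * z ^ k) = (K ** matrix_exp (mat z ** K)) $ i $ j"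
  proof -
    have "diffs (c i) k = (\<Sum>l\<in>UNIV. K $ i $ l * c l k)" for k
      by (simp add: diffs_def c_def matrix_matrix_mult_def sum_divide_distrib sum_distrib_left
          del: of_nat_Suc)
    moreover have "(\<lambda>k. \<Sum>l\<in>UNIV. K $ i $ l * (c l k * z ^ k)) sums
        (\<Sum>l\<in>UNIV. K $ i $ l * matrix_exp (mat z ** K) $ l $ j)"
      by (intro sums_sum sums_mult sums)
    moreover have "(K ** M) $ i $ j = (\<Sum>l\<in>UNIV. K $ i $ l * M $ l $ j)" for M :: "complex^'n^'n"
      by (simp add: matrix_matrix_mult_def)
    ultimately show ?thesis
      by (simp add: sums_iff sum_distrib_left mult_ac)
  qed
  ultimately show ?thesis by simp
qed

lemma has_vector_derivative_vecI:
  fixes f :: "real \<Rightarrow> 'a::real_normed_vector^'n::finite"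
  assumes "\<And>i. ((\<lambda>t. f t $ i) has_vector_derivative f' $ i) (at t within S)"
  shows "(f has_vector_derivative f') (at t within S)"
  using assms unfolding has_vector_derivative_def has_derivative_def
  by (auto intro!: vec_tendstoI bounded_linear_scaleR_left)

lemma has_vector_derivative_matrix_exp:
  fixes K :: "complex^'n::finite^'n"
  shows "((\<lambda>t. matrix_exp (mat (c * of_real t) ** K)) has_vector_derivative
    mat c ** K ** matrix_exp (mat (c * of_real t) ** K)) (at t within S)"
proof (intro has_vector_derivative_vecI)
  fix i j
  have "((\<lambda>t. c * of_real t) has_vector_derivative c) (at t within S)"
    by (auto intro!: derivative_eq_intros)
  from field_vector_diff_chain_within[OF this
      has_field_derivative_at_within[OF has_field_derivative_matrix_exp_nth[of K i j]]]
  show "((\<lambda>t. matrix_exp (mat (c * of_real t) ** K) $ i $ j) has_vector_derivative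
    (mat c ** K ** matrix_exp (mat (c * of_real t) ** K)) $ i $ j) (at t within S)"
    by (simp add: o_def matrix_mul_assoc[symmetric] mat_mult_nth)
qed

lemma matrix_exp_0 [simp]: "matrix_exp 0 = (mat 1 :: complex^'n::finite^'n)"
proof -
  have "matrix_pow 0 k = (0 :: complex^'n^'n)" if "k \<noteq> 0" for k
    using that by (cases k) auto
  then have "(\<lambda>k. (1 / fact k) *\<^sub>R matrix_pow (0 :: complex^'n^'n) k) sums
      (\<Sum>k\<in>{0}. (1 / fact k) *\<^sub>R matrix_pow (0 :: complex^'n^'n) k)"
    by (intro sums_finite) auto
  then show ?thesis
    using sums_unique2[OF matrix_exp_sums[of "0 :: complex^'n^'n"]] by simp
qed

text \<open>The exponential is a limit of polynomials in its argument.\<close>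

lemma matrix_exp_commute:
  fixes A :: "complex^'n::finite^'n"
  shows "matrix_exp (mat z ** A) ** A = A ** matrix_exp (mat z ** A)"
proof -
  have "(\<lambda>k. ((1 / fact k) *\<^sub>R matrix_pow (mat z ** A) k) ** A) sums (matrix_exp (mat z ** A) ** A)"
    by (intro bounded_linear.sums[OF mm.bounded_linear_left] matrix_exp_sums)
  moreover have "((1 / fact k) *\<^sub>R matrix_pow (mat z ** A) k) ** A
      = A ** ((1 / fact k) *\<^sub>R matrix_pow (mat z ** A) k)" for k
    by (simp add: scaleR_mult_matrix matrix_pow_mat_mult)
       (metis mat_commute matrix_mul_assoc matrix_pow_commute)
  moreover have "(\<lambda>k. A ** ((1 / fact k) *\<^sub>R matrix_pow (mat z ** A) k)) sums (A ** matrix_exp (mat z ** A))"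
    by (intro bounded_linear.sums[OF mm.bounded_linear_right] matrix_exp_sums)
  ultimately show ?thesis
    using sums_unique2 by simp
qed

text \<open>The curve \<open>exp (t A) exp (- t A)\<close> has derivative zero.\<close>

lemma matrix_exp_minus:
  fixes A :: "complex^'n::finite^'n"
  shows "matrix_exp A ** matrix_exp (- A) = mat 1"
proof -
  define E where "E z = matrix_exp (mat z ** A)" for z
  define f where "f t = E (1 * complex_of_real t) ** E (- 1 * of_real t)" for t
  have "(f has_vector_derivative 0) (at t within UNIV)" for t
  proof -
    have "(f has_vector_derivative E (1 * of_real t) ** (mat (- 1) ** A ** E (- 1 * of_real t))
        + mat 1 ** A ** E (1 * of_real t) ** E (- 1 * of_real t)) (at t within UNIV)"
      unfolding f_def E_def
      by (rule mm.has_vector_derivative; rule has_vector_derivative_matrix_exp)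
    moreover have "mat (- 1) = (- mat 1 :: complex^'n^'n)"
      by (simp add: vec_eq_iff mat_def)
    ultimately show ?thesis
      by (simp add: mm.minus_left mm.minus_right matrix_mul_assoc E_def matrix_exp_commute)
  qed
  then obtain c where c: "\<And>t. f t = c"
    using has_vector_derivative_zero_constant[of UNIV f] by (metis UNIV_I convex_UNIV)
  have "f 1 = f 0" using c by simp
  moreover have "mat (- 1) ** A = - A"
    by (simp add: vec_eq_iff mat_mult_nth)
  ultimately show ?thesis
    by (simp add: f_def E_def)
qed

lemma matrix_pow_cnj: "matrix_pow (map_matrix cnj A) k = map_matrix cnj (matrix_pow A k)"
proof (induction k)
  case (Suc k)
  then show ?case
    by (simp add: vec_eq_iff matrix_matrix_mult_def)
next
  case 0
  then show ?case by (simp add: vec_eq_iff mat_def)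
qed

lemma matrix_exp_cnj:
  fixes A :: "complex^'n::finite^'n"
  shows "matrix_exp (map_matrix cnj A) = map_matrix cnj (matrix_exp A)"
proof -
  have "matrix_exp (map_matrix cnj A) $ i $ j = cnj (matrix_exp A $ i $ j)" for i j
    using bounded_linear.sums[OF bounded_linear_cnj matrix_exp_nth_sums[of A i j]]
      matrix_exp_nth_sums[of "map_matrix cnj A" i j]
    by (simp add: sums_iff matrix_pow_cnj)
  then show ?thesis by (simp add: vec_eq_iff)
qed


section \<open>The logarithm near the identity\<close>

text \<open>Cramer's rule for the columns of the inverse exhibits the entries of the resolvent as rational
  functions of the spectral parameter.\<close>

lemma matrix_inv_cramer:
  fixes A :: "'a::field^'n::finite^'n"
  assumes "invertible A"
  shows "matrix_inv A $ k $ l = det (\<chi> i j. if j = k then (if i = l then 1 else 0) else A $ i $ j) / det A"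
proof -
  have "A *v column l (matrix_inv A) = column l (A ** matrix_inv A)"
    by (simp add: vec_eq_iff matrix_vector_mult_def matrix_matrix_mult_def column_def)
  also have "\<dots> = axis l 1"
    using assms by (simp add: matrix_inv_mult vec_eq_iff column_def mat_def axis_def)
  finally have "column l (matrix_inv A) =
      (\<chi> k. det (\<chi> i j. if j = k then axis l 1 $ i else A $ i $ j) / det A)"
    using assms by (simp add: cramer invertible_det_nz)
  then have "column l (matrix_inv A) $ k = det (\<chi> i j. if j = k then axis l 1 $ i else A $ i $ j) / det A"
    by simp
  then show ?thesis
    by (simp add: column_def axis_def eq_commute[of l] cong: if_cong)
qed

lemma holomorphic_on_det:
  fixes f :: "complex \<Rightarrow> complex^'n::finite^'n"
  assumes "\<And>i j. (\<lambda>z. f z $ i $ j) holomorphic_on S"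
  shows "(\<lambda>z. det (f z)) holomorphic_on S"
  unfolding det_def by (intro holomorphic_intros assms)

lemma holomorphic_on_resolvent:
  fixes M :: "complex^'n::finite^'n"
  assumes "S \<inter> matrix_spectrum M = {}"
  shows "(\<lambda>z. matrix_inv (mat z - M) $ k $ l) holomorphic_on S"
proof -
  have inv: "invertible (mat z - M)" if "z \<in> S" for z
    using assms that by (auto simp: matrix_spectrum_def)
  have ent: "(\<lambda>z. (mat z - M) $ i $ j) holomorphic_on S" for i j
    by (cases "i = j") (auto simp: mat_def intro!: holomorphic_intros)
  have "(\<lambda>z. det (\<chi> i j. if j = k then (if i = l then 1 else 0) else (mat z - M) $ i $ j) / det (mat z - M))
      holomorphic_on S"
  proof (intro holomorphic_on_divide holomorphic_on_det ent)
    show "(\<lambda>z. (\<chi> i j. if j = k then (if i = l then 1 else 0) else (mat z - M) $ i $ j) $ i $ j) holomorphic_on S" for i j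
      using ent[of i j] by (cases "j = k") auto
    show "det (mat z - M) \<noteq> 0" if "z \<in> S" for z
      using inv[OF that] by (simp add: invertible_det_nz)
  qed
  then show ?thesis
    by (rule holomorphic_transform) (simp add: matrix_inv_cramer inv)
qed

lemma matrix_spectrum_subset:
  fixes M :: "complex^'n::finite^'n"
  shows "matrix_spectrum M \<subseteq> cball 1 (norm (M - mat 1))"
proof
  fix z assume "z \<in> matrix_spectrum M"
  moreover have "mat z - M = mat (z - 1) - (M - mat 1)"
    by (simp add: vec_eq_iff mat_def)
  ultimately have "\<not> invertible (mat (z - 1) - (M - mat 1))"
    by (simp add: matrix_spectrum_def)
  then show "z \<in> cball 1 (norm (M - mat 1))"
    using invertible_near_mat[of "M - mat 1" "z - 1"]
    by (cases "norm (M - mat 1) < norm (z - 1)") (auto simp: dist_norm norm_minus_commute)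
qed

lemma finite_matrix_spectrum:
  fixes M :: "complex^'n::finite^'n"
  shows "finite (matrix_spectrum M)"
proof -
  let ?f = "\<lambda>z. det (mat z - M)"
  let ?K = "cball 1 (norm (M - mat 1)) :: complex set"
  have spec: "matrix_spectrum M = {z. ?f z = 0}"
    by (simp add: matrix_spectrum_def invertible_det_nz)
  have "finite {z \<in> ?K. ?f z = 0}"
  proof (cases "?f constant_on UNIV")
    case True
    define r where "r = norm (M - mat 1)"
    \<comment> \<open>A point outside of the disc that contains the spectrum, where the determinant does not vanish.\<close>
    define z where "z = 1 + complex_of_real (r + 1)"
    have "norm (1 - z) = \<bar>r + 1\<bar>"
      unfolding z_def by (metis add_diff_cancel_left' norm_minus_commute norm_of_real)
    then have "z \<notin> ?K"
      by (simp add: dist_norm r_def)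
    then have "?f z \<noteq> 0"
      using matrix_spectrum_subset[of M] spec by auto
    then show ?thesis
      using True by (auto simp: constant_on_def)
  next
    case False
    have "?f holomorphic_on UNIV"
    proof (intro holomorphic_on_det)
      show "(\<lambda>z. (mat z - M) $ i $ j) holomorphic_on UNIV" for i j
        by (cases "i = j") (auto simp: mat_def intro!: holomorphic_intros)
    qed
    from holomorphic_compact_finite_zeros[OF this open_UNIV connected_UNIV _ _ False, of ?K]
    show ?thesis by simp
  qed
  then show ?thesis
    using matrix_spectrum_subset[of M] spec by (metis (no_types, lifting) Collect_cong mem_Collect_eq subset_eq)
qed

text \<open>The integrand is holomorphic on the connected slit plane except at the finitely many points of
  the spectrum. The residue theorem expresses the integral through the residues and the
  winding numbers, and the latter are the same for all admissible contours.\<close>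

lemma contour_integral_Ln_contour_unique:
  fixes M :: "complex^'n::finite^'n"
  assumes "Ln_contour M \<gamma>" "Ln_contour M \<gamma>'"
  shows "contour_integral \<gamma> (\<lambda>z. Ln z * matrix_inv (mat z - M) $ i $ j) =
    contour_integral \<gamma>' (\<lambda>z. Ln z * matrix_inv (mat z - M) $ i $ j)"
proof -
  let ?f = "\<lambda>z. Ln z * matrix_inv (mat z - M) $ i $ j"
  have slit: "- \<real>\<^sub>\<le>\<^sub>0 = - (complex_of_real ` {..0})"
    by (auto simp: nonpos_Reals_def)
  have conn: "connected (- \<real>\<^sub>\<le>\<^sub>0 :: complex set)"
    unfolding slit by (intro simply_connected_imp_connected simply_connected_slotted_complex_plane_left)
  have "?f holomorphic_on - \<real>\<^sub>\<le>\<^sub>0 - matrix_spectrum M"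
    by (intro holomorphic_intros holomorphic_on_resolvent) auto
  then have res: "contour_integral g ?f = 2 * pi * \<i> * (\<Sum>p\<in>matrix_spectrum M. residue ?f p)"
    if "Ln_contour M g" for g
    using that Residue_theorem[OF _ conn finite_matrix_spectrum, of ?f M g]
    by (auto simp: open_Compl Ln_contour_def disjoint_iff subset_iff)
  show ?thesis
    using assms by (simp add: res)
qed

lemma Ln_contour_circlepath:
  fixes M :: "complex^'n::finite^'n"
  assumes "norm (M - mat 1) < 1/2"
  shows "Ln_contour M (circlepath 1 (1/2))"
proof -
  have Re: "Re z \<ge> 1/2" if "z \<in> cball 1 (1/2)" for z
    using that abs_Re_le_cmod[of "1 - z"] by (simp add: dist_norm)
  then have slit: "\<real>\<^sub>\<le>\<^sub>0 \<inter> cball 1 (1/2) = ({} :: complex set)"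
    by (force simp: complex_nonpos_Reals_iff)
  have "winding_number (circlepath 1 (1/2)) z = 0" if "z \<in> \<real>\<^sub>\<le>\<^sub>0" for z
    using that slit by (intro winding_number_zero_outside[where s = "cball 1 (1/2)"]) auto
  moreover have "winding_number (circlepath 1 (1/2)) z = 1" if "z \<in> matrix_spectrum M" for z
    using that matrix_spectrum_subset[of M] assms
    by (intro winding_number_circlepath) (force simp: dist_norm norm_minus_commute)
  moreover have "sphere 1 (1/2) \<inter> matrix_spectrum M = {}"
    using matrix_spectrum_subset[of M] assms by fastforce
  ultimately show ?thesis
    using slit by (auto simp: Ln_contour_def)
qed

text \<open>Hence for \<open>M\<close> near the identity the contour chosen in \<^const>\<open>matrix_Ln\<close> may be replaced by a fixed
  circle.\<close>

lemma matrix_Ln_circlepath: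
  fixes M :: "complex^'n::finite^'n"
  assumes "norm (M - mat 1) < 1/2"
  shows "matrix_Ln M $ i $ j = 1 / (2 * of_real pi * \<i>) *
    contour_integral (circlepath 1 (1/2)) (\<lambda>z. Ln z * matrix_inv (mat z - M) $ i $ j)"
proof -
  have "Ln_contour M (SOME \<gamma>. Ln_contour M \<gamma>)"
    using Ln_contour_circlepath[OF assms] by (rule someI[of "Ln_contour M"])
  from contour_integral_Ln_contour_unique[OF this Ln_contour_circlepath[OF assms]]
  show ?thesis by (simp add: matrix_Ln_def Let_def)
qed


text \<open>For holomorphic \<open>f\<close> and \<open>M\<close> near the identity this is \<open>2\<pi>i f(M)\<close> in the sense of the holomorphic
  functional calculus.\<close>

definition resolvent_integral :: "complex^'n::finite^'n \<Rightarrow> (complex \<Rightarrow> complex) \<Rightarrow> complex^'n^'n" where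
  "resolvent_integral M f =
     (\<chi> i j. contour_integral (circlepath 1 (1/2)) (\<lambda>z. f z * matrix_inv (mat z - M) $ i $ j))"

lemma resolvent_integral_cong:
  assumes "\<And>z. z \<in> sphere 1 (1/2) \<Longrightarrow> f z = g z"
  shows "resolvent_integral M f = resolvent_integral M g"
  unfolding resolvent_integral_def vec_eq_iff using assms
  by (auto intro!: contour_integral_eq)

lemma has_contour_integral_resolvent:
  fixes M :: "complex^'n::finite^'n"
  assumes M: "norm (M - mat 1) < 1/2" and f: "continuous_on (sphere 1 (1/2)) f"
  shows "((\<lambda>z. f z * (A ** matrix_inv (mat z - M)) $ i $ j) has_contour_integral
    (A ** resolvent_integral M f) $ i $ j) (circlepath 1 (1/2))"
proof -
  have "sphere 1 (1/2) \<inter> matrix_spectrum M = {}"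
    using matrix_spectrum_subset[of M] M by fastforce
  then have "continuous_on (sphere 1 (1/2)) (\<lambda>z. matrix_inv (mat z - M) $ i $ j)" for i j
    by (intro holomorphic_on_imp_continuous_on holomorphic_on_resolvent)
  then have "((\<lambda>z. f z * matrix_inv (mat z - M) $ i $ j) has_contour_integral
      resolvent_integral M f $ i $ j) (circlepath 1 (1/2))" for i j
    unfolding resolvent_integral_def using f
    by (auto intro!: has_contour_integral_integral contour_integrable_continuous_circlepath continuous_on_mult)
  then have "((\<lambda>z. \<Sum>k\<in>UNIV. A $ i $ k * (f z * matrix_inv (mat z - M) $ k $ j)) has_contour_integral
      (\<Sum>k\<in>UNIV. A $ i $ k * resolvent_integral M f $ k $ j)) (circlepath 1 (1/2))"
    by (intro has_contour_integral_sum has_contour_integral_lmul) simp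
  then show ?thesis
    by (simp add: matrix_matrix_mult_def sum_distrib_left mult_ac)
qed

lemma resolvent_mult:
  fixes M :: "complex^'n::finite^'n"
  assumes M: "norm (M - mat 1) < 1/2" and z: "z \<in> sphere 1 (1/2)"
  shows "(mat z - M) ** matrix_inv (mat z - M) = mat 1"
proof -
  have "z \<notin> matrix_spectrum M"
    using matrix_spectrum_subset[of M] M z by fastforce
  then show ?thesis
    by (simp add: matrix_spectrum_def matrix_inv_mult)
qed

text \<open>The algebraic rule of the functional calculus: if \<open>w(z) - A\<close> is divisible by \<open>z - M\<close>, then
  multiplication of the integrand by \<open>w\<close> multiplies the result by \<open>A\<close>, up to the integral of the
  quotient, in which the resolvent has cancelled.\<close>

lemma resolvent_integral_mult:
  fixes M :: "complex^'n::finite^'n"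
  assumes M: "norm (M - mat 1) < 1/2"
    and cont: "continuous_on (sphere 1 (1/2)) f" "continuous_on (sphere 1 (1/2)) w"
    and eq: "\<And>z. z \<in> sphere 1 (1/2) \<Longrightarrow> mat (w z) = A + mat (g z) ** B ** (mat z - M)"
    and c: "((\<lambda>z. f z * g z) has_contour_integral c) (circlepath 1 (1/2))"
  shows "resolvent_integral M (\<lambda>z. f z * w z) = A ** resolvent_integral M f + mat c ** B"
proof -
  have "resolvent_integral M (\<lambda>z. f z * w z) $ i $ j = (A ** resolvent_integral M f + mat c ** B) $ i $ j"
    for i j
  proof (rule has_contour_integral_unique)
    show "((\<lambda>z. (f z * w z) * (mat 1 ** matrix_inv (mat z - M)) $ i $ j) has_contour_integral
        resolvent_integral M (\<lambda>z. f z * w z) $ i $ j) (circlepath 1 (1/2))"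
      using has_contour_integral_resolvent[OF M continuous_on_mult[OF cont], of "mat 1" i j] by simp
    have "((\<lambda>z. f z * (A ** matrix_inv (mat z - M)) $ i $ j + f z * g z * B $ i $ j) has_contour_integral
        (A ** resolvent_integral M f) $ i $ j + c * B $ i $ j) (circlepath 1 (1/2))"
      by (intro has_contour_integral_add has_contour_integral_resolvent M cont has_contour_integral_rmul c)
    moreover have "f z * (A ** matrix_inv (mat z - M)) $ i $ j + f z * g z * B $ i $ j =
        (f z * w z) * (mat 1 ** matrix_inv (mat z - M)) $ i $ j" if "z \<in> sphere 1 (1/2)" for z
    proof -
      have "mat (w z) ** matrix_inv (mat z - M) = A ** matrix_inv (mat z - M) + mat (g z) ** B"
        using resolvent_mult[OF M that]
        by (simp add: eq[OF that] mm.add_left matrix_mul_assoc[symmetric])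
      then have "(mat (w z) ** matrix_inv (mat z - M)) $ i $ j
          = (A ** matrix_inv (mat z - M)) $ i $ j + (mat (g z) ** B) $ i $ j"
        by simp
      then have "w z * matrix_inv (mat z - M) $ i $ j = (A ** matrix_inv (mat z - M)) $ i $ j + g z * B $ i $ j"
        by (simp add: mat_mult_nth)
      then show ?thesis by (simp add: algebra_simps)
    qed
    ultimately show "((\<lambda>z. (f z * w z) * (mat 1 ** matrix_inv (mat z - M)) $ i $ j) has_contour_integral
        (A ** resolvent_integral M f + mat c ** B) $ i $ j) (circlepath 1 (1/2))"
      by (subst (asm) has_contour_integral_cong[where g = "circlepath 1 (1/2)"]) 
         (auto elim: has_contour_integral_eq simp: mat_mult_nth)
  qed
  then show ?thesis by (simp add: vec_eq_iff)
qed

text \<open>Solve \<open>(z - 1) r = 1 + (M - 1) r\<close>, the defining equation of the resolvent \<open>r\<close>, for its norm, with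
  \<open>|z - 1| = 1/2\<close> and \<open>|M - 1| \<le> 1/4\<close>.\<close>

lemma norm_resolvent_le:
  fixes M :: "complex^'n::finite^'n"
  assumes M: "norm (M - mat 1) \<le> 1/4" and z: "z \<in> sphere 1 (1/2)"
  shows "norm (matrix_inv (mat z - M)) \<le> 4 * norm (mat 1 :: complex^'n^'n)"
proof -
  let ?r = "matrix_inv (mat z - M)"
  have "mat (z - 1) = (mat z - M) + (M - mat 1)"
    by (simp add: vec_eq_iff mat_def)
  then have "mat (z - 1) ** ?r = (mat z - M) ** ?r + (M - mat 1) ** ?r"
    by (simp only: mm.add_left)
  then have "mat (z - 1) ** ?r = mat 1 + (M - mat 1) ** ?r"
    using resolvent_mult[OF _ z, of M] M by simp
  moreover have "norm (mat (z - 1) ** ?r) = norm (z - 1) * norm ?r"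
    by (simp add: norm_vec_def mat_mult_nth norm_mult L2_set_right_distrib)
  moreover have "norm (z - 1) = 1/2"
    using z by (simp add: dist_norm norm_minus_commute)
  ultimately have "norm ?r / 2 \<le> norm (mat 1 :: complex^'n^'n) + norm ((M - mat 1) ** ?r)"
    using norm_triangle_ineq[of "mat 1" "(M - mat 1) ** ?r"] by simp
  also have "norm ((M - mat 1) ** ?r) \<le> norm (M - mat 1) * norm ?r"
    by (rule norm_matrix_mult_le)
  also have "\<dots> \<le> 1/4 * norm ?r"
    by (intro mult_right_mono M) simp
  finally show ?thesis by simp
qed

text \<open>A Neumann series argument: let \<open>a m\<close> be the integral of \<open>(z - 1)\<^sup>-\<^sup>m\<close> against the resolvent and
  \<open>N = M - 1\<close>. Then \<open>a 0 = 2\<pi>i + N a 1\<close>, and \<open>a m = N a (m + 1)\<close> for \<open>m \<ge> 1\<close>. Since \<open>a m\<close> grows at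
  most like \<open>2\<^sup>m\<close> while \<open>N\<^sup>m\<close> decays like \<open>4\<^sup>-\<^sup>m\<close>, the matrix \<open>a 1\<close> vanishes.\<close>

lemma resolvent_integral_1:
  fixes M :: "complex^'n::finite^'n"
  assumes M: "norm (M - mat 1) \<le> 1/4"
  shows "resolvent_integral M (\<lambda>z. 1) = mat (2 * of_real pi * \<i>)"
proof -
  define N where "N = M - mat 1"
  define a where "a m = resolvent_integral M (\<lambda>z. 1 / (z - 1) ^ m)" for m
  have M': "norm (M - mat 1) < 1/2" using M by simp
  have step: "a m = N ** a (Suc m) + mat (if m = 0 then 2 * of_real pi * \<i> else 0)" for m
  proof -
    have "a m = resolvent_integral M (\<lambda>z. 1 / (z - 1) ^ Suc m * (z - 1))"
      unfolding a_def by (rule resolvent_integral_cong) auto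
    also have "\<dots> = N ** a (Suc m) + mat (if m = 0 then 2 * of_real pi * \<i> else 0) ** mat 1"
      unfolding a_def
    proof (rule resolvent_integral_mult[OF M', where g = "\<lambda>z. 1"])
      show "continuous_on (sphere 1 (1/2)) (\<lambda>z. 1 / (z - 1) ^ Suc m :: complex)"
        by (intro continuous_intros) auto
      show "continuous_on (sphere 1 (1/2)) (\<lambda>z. z - 1 :: complex)"
        by (intro continuous_intros)
      show "mat (z - 1) = N + mat 1 ** mat 1 ** (mat z - M)" for z
        by (simp add: N_def) (simp add: vec_eq_iff mat_def)
      have "contour_integral (circlepath 1 (1/2)) (\<lambda>u. 1 / (u - 1) ^ Suc m)
          = 2 * pi * \<i> * (deriv ^^ m) (\<lambda>_. 1) 1 / fact m"
        by (intro Cauchy_contour_integral_circlepath) auto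
      moreover have "(\<lambda>u::complex. 1 / (u - 1) ^ Suc m) contour_integrable_on circlepath 1 (1/2)"
        by (intro contour_integrable_continuous_circlepath continuous_intros) auto
      ultimately show "((\<lambda>z. 1 / (z - 1) ^ Suc m * 1) has_contour_integral
          (if m = 0 then 2 * of_real pi * \<i> else 0)) (circlepath 1 (1/2))"
        using has_contour_integral_integral by (fastforce simp: higher_deriv_const)
    qed
    finally show ?thesis by simp
  qed
  have pow: "a 1 = matrix_pow N k ** a (Suc k)" for k
  proof (induction k)
    case (Suc k)
    have "a (Suc k) = N ** a (Suc (Suc k))"
      using step[of "Suc k"] by simp
    then have "a 1 = matrix_pow N k ** (N ** a (Suc (Suc k)))"
      using Suc by simp
    then show ?case
      by (simp only: matrix_mul_assoc matrix_pow_commute matrix_pow.simps)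
  qed simp
  define B where "B = 4 * norm (mat 1 :: complex^'n^'n)"
  have entry: "norm (a m $ i $ j) \<le> B * 2 ^ m * pi" for m i j
  proof -
    have "norm (a m $ i $ j) \<le> (B * 2 ^ m) * (2 * pi * (1/2))"
    proof (rule has_contour_integral_bound_circlepath)
      show "((\<lambda>z. 1 / (z - 1) ^ m * (mat 1 ** matrix_inv (mat z - M)) $ i $ j) has_contour_integral
          a m $ i $ j) (circlepath 1 (1/2))"
      proof -
        have "continuous_on (sphere 1 (1/2)) (\<lambda>z. 1 / (z - 1) ^ m :: complex)"
          by (intro continuous_intros) auto
        from has_contour_integral_resolvent[OF M' this, of "mat 1" i j]
        show ?thesis by (simp add: a_def)
      qed
      fix z :: complex assume z: "norm (z - 1) = 1/2"
      then have "norm (matrix_inv (mat z - M)) \<le> B"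
        unfolding B_def by (intro norm_resolvent_le M) (simp add: dist_norm norm_minus_commute)
      then have "norm (matrix_inv (mat z - M) $ i $ j) \<le> B"
        by (meson order_trans norm_matrix_nth_le)
      then show "norm (1 / (z - 1) ^ m * (mat 1 ** matrix_inv (mat z - M)) $ i $ j) \<le> B * 2 ^ m"
      proof -
        have "norm (1 / (z - 1) ^ m) = 2 ^ m"
          by (simp only: norm_divide norm_power z norm_one) (simp add: power_divide)
        then show ?thesis
          using \<open>norm (matrix_inv (mat z - M) $ i $ j) \<le> B\<close>
          by (simp only: norm_mult matrix_mul_lid) simp
      qed
    qed (auto simp: B_def)
    then show ?thesis by simp
  qed
  define C where "C = (\<Sum>i\<in>(UNIV::'n set). \<Sum>j\<in>(UNIV::'n set). B * pi)"
  have norm_a: "norm (a m) \<le> C * 2 ^ m" for m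
  proof -
    have "norm (a m) \<le> (\<Sum>i\<in>UNIV. norm (a m $ i))"
      unfolding norm_vec_def[of "a m"] by (intro L2_set_le_sum) auto
    also have "\<dots> \<le> (\<Sum>i\<in>UNIV. \<Sum>j\<in>UNIV. norm (a m $ i $ j))"
      unfolding norm_vec_def[of "a m $ _"] by (intro sum_mono L2_set_le_sum) auto
    also have "\<dots> \<le> (\<Sum>i\<in>(UNIV::'n set). \<Sum>j\<in>(UNIV::'n set). B * 2 ^ m * pi)"
      by (intro sum_mono entry)
    finally show ?thesis by (simp add: C_def mult_ac)
  qed
  have "norm (a 1) \<le> (norm (mat 1 :: complex^'n^'n) * C * 2) * (1/2) ^ k" for k
  proof -
    have "norm (a 1) \<le> norm (matrix_pow N k) * norm (a (Suc k))"
      by (subst pow[of k]) (rule norm_matrix_mult_le)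
    also have "\<dots> \<le> (norm (mat 1 :: complex^'n^'n) * (1/4) ^ k) * (C * 2 ^ Suc k)"
    proof (intro mult_mono norm_a)
      have "norm (matrix_pow N k) \<le> norm (mat 1 :: complex^'n^'n) * norm N ^ k"
        by (rule norm_matrix_pow_le)
      also have "\<dots> \<le> norm (mat 1 :: complex^'n^'n) * (1/4) ^ k"
        using M by (intro mult_left_mono power_mono) (auto simp: N_def)
      finally show "norm (matrix_pow N k) \<le> norm (mat 1 :: complex^'n^'n) * (1/4) ^ k" .
    qed auto
    also have "(1/4::real) ^ k * 2 ^ Suc k = 2 * (1/2) ^ k"
      by (simp add: power_divide power_mult_distrib[symmetric] flip: power_mult)
        (simp add: field_simps flip: power_mult_distrib)
    then have "(norm (mat 1 :: complex^'n^'n) * (1/4) ^ k) * (C * 2 ^ Suc k)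
        = (norm (mat 1 :: complex^'n^'n) * C * 2) * (1/2) ^ k"
      by (simp add: mult_ac)
    finally show ?thesis .
  qed
  moreover have "(\<lambda>k. (norm (mat 1 :: complex^'n^'n) * C * 2) * (1/2) ^ k) \<longlonglongrightarrow> 0"
    by (intro tendsto_mult_right_zero LIMSEQ_realpow_zero) auto
  ultimately have "norm (a 1) \<le> 0"
    by (intro LIMSEQ_le_const) auto
  then have "a 1 = 0" by simp
  with step[of 0] show ?thesis
    by (simp add: a_def)
qed

lemma Ln_artanh_sums:
  fixes w :: complex
  assumes "norm w < 1"
  shows "(\<lambda>n. of_real (if odd n then 2 / real n else 0) * w ^ n) sums Ln ((1 + w) / (1 - w))"
proof -
  have half: "\<bar>Im (Ln (1 + v))\<bar> < pi / 2 \<and> 1 + v \<noteq> 0" if "norm v < 1" for v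
  proof -
    have "Re (1 + v) > 0" using that abs_Re_le_cmod[of v] by auto
    then show ?thesis using Re_Ln_pos_lt by (auto simp: complex_eq_iff)
  qed
  have "Ln ((1 + w) / (1 - w)) = Ln (1 + w) - Ln (1 - w)"
  proof (rule Ln_unique)
    show "exp (Ln (1 + w) - Ln (1 - w)) = (1 + w) / (1 - w)"
      using half[of w] half[of "- w"] assms by (simp add: exp_diff)
  qed (use half[of w] half[of "- w"] assms in auto)
  moreover have "(\<lambda>n. - ((- w) ^ n) / of_nat n - (- ((- (- w)) ^ n) / of_nat n)) sums (Ln (1 + w) - Ln (1 + - w))"
    using assms by (intro sums_diff Ln_series') auto
  moreover have "- ((- w) ^ n) / of_nat n - (- ((- (- w)) ^ n) / of_nat n)
      = of_real (if odd n then 2 / real n else 0) * w ^ n" for n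
    by (auto simp: add_divide_distrib[symmetric])
  ultimately show ?thesis by simp
qed

text \<open>In terms of the Cayley transform \<open>W = (M - 1)(M + 1)\<^sup>-\<^sup>1\<close> the logarithm is the odd power series
  \<open>2 artanh W\<close>. With \<open>w = (z - 1)/(z + 1)\<close> one has \<open>Ln z = 2 artanh w\<close>, uniformly on the circle, and
  the powers of \<open>w\<close> integrate against the resolvent of \<open>M\<close> to those of \<open>W\<close>, because \<open>w - W\<close> is
  divisible by \<open>z - M\<close> with the quotient \<open>(1 - W)/(z + 1)\<close>, which is holomorphic in the disc.\<close>

lemma matrix_Ln_sums:
  fixes M W :: "complex^'n::finite^'n"
  assumes W: "norm W \<le> 1/10" and MW: "M ** (mat 1 - W) = mat 1 + W"
  shows "(\<lambda>n. (if odd n then 2 / real n else 0) *\<^sub>R matrix_pow W n) sums matrix_Ln M"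
proof -
  define c where "c n = (if odd n then 2 / real n else 0)" for n
  define w where "w z = (z - 1) / (z + 1)" for z :: complex
  let ?S = "sphere 1 (1/2) :: complex set"
  have M: "norm (M - mat 1) \<le> 1/4"
  proof -
    have "M - mat 1 = 2 *\<^sub>R W + (M - mat 1) ** W"
      using MW by (simp add: mm.diff_right mm.diff_left scaleR_2 algebra_simps)
    then have "norm (M - mat 1) \<le> norm (2 *\<^sub>R W) + norm ((M - mat 1) ** W)"
      by (metis norm_triangle_ineq)
    also have "\<dots> \<le> 2 * norm W + norm (M - mat 1) * norm W"
      using norm_matrix_mult_le[of "M - mat 1" W] by simp
    also have "norm (M - mat 1) * norm W \<le> norm (M - mat 1) * (1/10)"
      by (intro mult_left_mono W) simp
    finally show ?thesis using W by simp
  qed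
  then have M': "norm (M - mat 1) < 1/2" by simp
  \<comment> \<open>As a function of \<open>W\<close>, the matrix \<open>M\<close> commutes with it.\<close>
  have WM: "(mat 1 - W) ** M = mat 1 + W"
  proof -
    have inv: "invertible (mat 1 - W)"
      using W by (intro invertible_near_mat) simp
    have "(mat 1 - W) ** M ** (mat 1 - W) = (mat 1 - W) ** (mat 1 + W)"
      by (simp add: MW matrix_mul_assoc[symmetric])
    also have "\<dots> = (mat 1 + W) ** (mat 1 - W)"
      by (simp add: mm.diff_right mm.diff_left mm.add_left mm.add_right)
    finally have "((mat 1 - W) ** M ** (mat 1 - W)) ** matrix_inv (mat 1 - W) =
        ((mat 1 + W) ** (mat 1 - W)) ** matrix_inv (mat 1 - W)"
      by (rule arg_cong)
    then show ?thesis
      by (simp add: matrix_mul_assoc[symmetric] matrix_inv_mult(1)[OF inv])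
  qed
  then have WM': "W ** M = M - mat 1 - W"
    by (simp add: mm.diff_left algebra_simps)
  have Re: "Re z \<ge> 1/2" if "z \<in> cball 1 (1/2)" for z
    using that abs_Re_le_cmod[of "1 - z"] by (simp add: dist_norm)
  have nz: "z + 1 \<noteq> 0" if "z \<in> cball 1 (1/2)" for z :: complex
    using Re[OF that] by (auto simp: complex_eq_iff)
  have holo: "w holomorphic_on cball 1 (1/2)"
    unfolding w_def using nz by (intro holomorphic_intros) auto
  have w_le: "norm (w z) \<le> 1/3" if "z \<in> ?S" for z
  proof -
    have "norm (z + 1) \<ge> 3/2"
      using complex_Re_le_cmod[of "z + 1"] Re[of z] that by simp
    moreover have "norm (z - 1) = 1/2"
      using that by (simp add: dist_norm norm_minus_commute)
    ultimately have "norm (z - 1) / norm (z + 1) \<le> (1/2) / (3/2)"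
      by (intro frac_le) auto
    then show ?thesis
      by (simp add: w_def norm_divide)
  qed
  have powers: "resolvent_integral M (\<lambda>z. w z ^ k) = mat (2 * of_real pi * \<i>) ** matrix_pow W k" for k
  proof (induction k)
    case 0
    then show ?case using resolvent_integral_1[OF M] by simp
  next
    case (Suc k)
    have "resolvent_integral M (\<lambda>z. w z ^ k * w z) =
        W ** resolvent_integral M (\<lambda>z. w z ^ k) + mat 0 ** (mat 1 - W)"
    proof (rule resolvent_integral_mult[OF M', where g = "\<lambda>z. 1 / (z + 1)"])
      show "continuous_on ?S (\<lambda>z. w z ^ k)" "continuous_on ?S w"
        using holomorphic_on_imp_continuous_on[OF holo]
        by (auto intro!: continuous_intros intro: continuous_on_subset)
      have "(\<lambda>z. w z ^ k * (1 / (z + 1))) holomorphic_on cball 1 (1/2)"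
        using nz by (intro holomorphic_intros holo) auto
      then show "((\<lambda>z. w z ^ k * (1 / (z + 1))) has_contour_integral 0) (circlepath 1 (1/2))"
        by (rule Cauchy_theorem_convex_simple) auto
      fix z assume "z \<in> ?S"
      then have z: "z + 1 \<noteq> 0" using nz by simp
      have "(mat 1 - W) ** (mat z - M) = mat z - mat z ** W - mat 1 - W"
        by (simp add: WM' mm.diff_left mm.diff_right mat_commute)
      then have "mat (z - 1) = mat (z + 1) ** W + (mat 1 - W) ** (mat z - M)"
      proof -
        assume "(mat 1 - W) ** (mat z - M) = mat z - mat z ** W - mat 1 - W"
        moreover have "mat (z - 1) = mat z - (mat 1 :: complex^'n^'n)"
          "mat (z + 1) = mat z + (mat 1 :: complex^'n^'n)"
          by (simp_all add: vec_eq_iff mat_def)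
        ultimately show ?thesis by (simp add: mm.add_left)
      qed
      then have "mat (1 / (z + 1)) ** mat (z - 1) = mat (1 / (z + 1)) ** (mat (z + 1) ** W + (mat 1 - W) ** (mat z - M))"
        by simp
      then show "mat (w z) = W + mat (1 / (z + 1)) ** (mat 1 - W) ** (mat z - M)"
        using z by (simp add: mat_mult_mat mm.add_right matrix_mul_assoc w_def)
    qed
    then show ?case
      by (simp add: Suc mult.commute) (metis mat_commute matrix_mul_assoc)
  qed
  have "(\<lambda>n. c n *\<^sub>R matrix_pow W n $ i $ j) sums matrix_Ln M $ i $ j" for i j
  proof -
    let ?r = "\<lambda>z. matrix_inv (mat z - M) $ i $ j"
    let ?f = "\<lambda>n z. of_real (c n) * w z ^ n * ?r z"
    define B where "B = 4 * norm (mat 1 :: complex^'n^'n)"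
    have int: "((\<lambda>z. w z ^ n * (mat 1 ** matrix_inv (mat z - M)) $ i $ j) has_contour_integral
        (mat 1 ** resolvent_integral M (\<lambda>z. w z ^ n)) $ i $ j) (circlepath 1 (1/2))" for n
      using holomorphic_on_imp_continuous_on[OF holo]
      by (intro has_contour_integral_resolvent[OF M'])
        (auto intro!: continuous_intros intro: continuous_on_subset)
    have int_f: "(?f n has_contour_integral of_real (c n) * (2 * of_real pi * \<i> * matrix_pow W n $ i $ j))
        (circlepath 1 (1/2))" for n
      using has_contour_integral_lmul[OF int[of n], of "of_real (c n)"]
      by (simp add: powers mat_mult_nth mult_ac)
    have "norm (?f n z) \<le> (2 * B) * (1/3) ^ n" if "z \<in> ?S" for n z
    proof -
      have "norm (?f n z) = c n * norm (w z) ^ n * norm (?r z)"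
        by (simp add: norm_mult norm_power c_def)
      also have "\<dots> \<le> 2 * (1/3) ^ n * B"
      proof (intro mult_mono power_mono w_le that)
        show "c n \<le> 2" by (auto simp: c_def field_simps elim!: oddE)
        show "norm (?r z) \<le> B"
          using norm_resolvent_le[OF M that] unfolding B_def by (meson order_trans norm_matrix_nth_le)
      qed auto
      finally show ?thesis by (simp add: mult_ac)
    qed
    moreover have "summable (\<lambda>n. (2 * B) * (1/3) ^ n)"
      by (intro summable_mult summable_geometric) auto
    ultimately have "uniform_limit ?S (\<lambda>m z. \<Sum>n<m. ?f n z) (\<lambda>z. \<Sum>n. ?f n z) sequentially"
      by (rule Weierstrass_m_test)
    then have lim: "((\<lambda>m. contour_integral (circlepath 1 (1/2)) (\<lambda>z. \<Sum>n<m. ?f n z)) \<longlongrightarrow>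
        contour_integral (circlepath 1 (1/2)) (\<lambda>z. \<Sum>n. ?f n z)) sequentially"
      using int_f
      by (intro contour_integral_uniform_limit_circlepath(2) always_eventually allI contour_integrable_sum)
        (auto simp: contour_integrable_on_def)
    have "(\<Sum>n. ?f n z) = Ln z * ?r z" if "z \<in> ?S" for z
    proof -
      have "1 + w z = 2 * z / (z + 1)" "1 - w z = 2 / (z + 1)"
        using nz[of z] that by (simp_all add: w_def field_simps)
      then have "(1 + w z) / (1 - w z) = z"
        using nz[of z] that by simp
      then have "(\<lambda>n. of_real (c n) * w z ^ n) sums Ln z"
        using Ln_artanh_sums[of "w z"] w_le[OF that] by (simp add: c_def)
      from sums_mult2[OF this, of "?r z"] show ?thesis
        by (simp add: sums_iff)
    qed
    then have "contour_integral (circlepath 1 (1/2)) (\<lambda>z. \<Sum>n. ?f n z) =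
        contour_integral (circlepath 1 (1/2)) (\<lambda>z. Ln z * ?r z)"
      by (intro contour_integral_eq) simp
    also have "\<dots> = 2 * of_real pi * \<i> * matrix_Ln M $ i $ j"
      by (simp add: matrix_Ln_circlepath[OF M'])
    finally have "((\<lambda>m. contour_integral (circlepath 1 (1/2)) (\<lambda>z. \<Sum>n<m. ?f n z)) \<longlongrightarrow>
        2 * of_real pi * \<i> * matrix_Ln M $ i $ j) sequentially"
      using lim by simp
    moreover have "contour_integral (circlepath 1 (1/2)) (\<lambda>z. \<Sum>n<m. ?f n z) =
        (\<Sum>n<m. of_real (c n) * (2 * of_real pi * \<i> * matrix_pow W n $ i $ j))" for m
      by (intro contour_integral_unique has_contour_integral_sum int_f) auto
    ultimately have "(\<lambda>n. of_real (c n) * (2 * of_real pi * \<i> * matrix_pow W n $ i $ j)) sums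
        (2 * of_real pi * \<i> * matrix_Ln M $ i $ j)"
      by (simp add: sums_def)
    moreover define q where "q = 2 * complex_of_real pi * \<i>"
    ultimately have "(\<lambda>n. of_real (c n) * (q * matrix_pow W n $ i $ j)) sums (q * matrix_Ln M $ i $ j)"
      by simp
    moreover have q0: "q \<noteq> 0"
      by (simp add: q_def)
    ultimately show ?thesis
      using sums_mult[of "\<lambda>n. of_real (c n) * (q * matrix_pow W n $ i $ j)" "q * matrix_Ln M $ i $ j" "1 / q"]
      by (simp add: scaleR_conv_of_real mult.left_commute[of _ q])
  qed
  then show ?thesis
    unfolding sums_def c_def[symmetric]
    by (intro vec_tendstoI) (simp add: sum_component)
qed


lemma matrix_Ln_approx:
  fixes M W :: "complex^'n::finite^'n"
  assumes W: "norm W \<le> 1/10" and MW: "M ** (mat 1 - W) = mat 1 + W"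
  shows "norm (matrix_Ln M - 2 *\<^sub>R W) \<le> 4 * norm (mat 1 :: complex^'n^'n) * (norm W)\<^sup>2"
proof -
  define f where "f n = (if odd n then 2 / real n else 0) *\<^sub>R matrix_pow W n" for n
  let ?c = "2 * norm (mat 1 :: complex^'n^'n) * (norm W)\<^sup>2"
  have "f sums matrix_Ln M"
    unfolding f_def[abs_def] by (rule matrix_Ln_sums[OF W MW])
  then have "(\<lambda>n. f (n + 2)) sums (matrix_Ln M - (\<Sum>n<2. f n))"
    by (simp only: sums_iff_shift)  simp
  moreover have "(\<Sum>n<2. f n) = 2 *\<^sub>R W"
    by (simp add: f_def numeral_2_eq_2)
  ultimately have f: "(\<lambda>n. f (n + 2)) sums (matrix_Ln M - 2 *\<^sub>R W)"
    by simp
  have "norm (f (n + 2)) \<le> ?c * (1/10) ^ n" for n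
  proof -
    have "norm (f (n + 2)) \<le> 2 * norm (matrix_pow W (n + 2))"
      unfolding f_def norm_scaleR by (intro mult_right_mono) (auto simp: field_simps)
    also have "\<dots> \<le> 2 * (norm (mat 1 :: complex^'n^'n) * norm W ^ (n + 2))"
      by (intro mult_left_mono norm_matrix_pow_le) simp
    also have "\<dots> \<le> 2 * (norm (mat 1 :: complex^'n^'n) * ((norm W)\<^sup>2 * (1/10) ^ n))"
    proof (intro mult_left_mono)
      have "norm W ^ (n + 2) = (norm W)\<^sup>2 * norm W ^ n"
        by (simp add: power_add power2_eq_square)
      also have "\<dots> \<le> (norm W)\<^sup>2 * (1/10) ^ n"
        by (intro mult_left_mono power_mono W) auto
      finally show "norm W ^ (n + 2) \<le> (norm W)\<^sup>2 * (1/10) ^ n" .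
    qed auto
    finally show ?thesis by (simp add: mult_ac)
  qed
  moreover have geo: "(\<lambda>n. ?c * (1/10) ^ n) sums (?c * (1 / (1 - 1/10)))"
    by (intro sums_mult geometric_sums) simp
  ultimately have "norm (matrix_Ln M - 2 *\<^sub>R W) \<le> ?c * (1 / (1 - 1/10))"
    using norm_suminf_le[of "\<lambda>n. f (n + 2)" "\<lambda>n. ?c * (1/10) ^ n"] f geo by (simp add: sums_iff)
  also have "\<dots> \<le> 2 * ?c" by simp
  finally show ?thesis by simp
qed

section \<open>Positive semidefinite quadratic forms\<close>

definition qf :: "real^'n::finite^'n \<Rightarrow> real^'n \<Rightarrow> real" where
  "qf R x = x \<bullet> (R *v x)"

definition psd :: "real^'n::finite^'n \<Rightarrow> bool" where
  "psd R \<longleftrightarrow> transpose R = R \<and> (\<forall>x. 0 \<le> qf R x)"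

lemma psd_nonneg: "psd R \<Longrightarrow> 0 \<le> qf R x"
  by (simp add: psd_def)

lemma inner_matrix_transpose:
  fixes A :: "real^'n::finite^'m::finite"
  shows "x \<bullet> (A *v y) = (transpose A *v x) \<bullet> y"
  by (simp add: dot_lmul_matrix)

lemma sym_inner_commute:
  fixes R :: "real^'n::finite^'n"
  assumes "transpose R = R"
  shows "x \<bullet> (R *v y) = y \<bullet> (R *v x)"
  using inner_matrix_transpose[of x R y] assms by (simp add: inner_commute)

lemma transpose_eqI:
  fixes C :: "real^'n::finite^'n"
  assumes "\<And>x y. x \<bullet> (C *v y) = y \<bullet> (C *v x)"
  shows "transpose C = C"
proof -
  have "C $ i $ j = C $ j $ i" for i j
    using assms[of "axis i 1" "axis j 1"]
    by (simp add: matrix_vector_mult_basis inner_axis' column_def)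
  then show ?thesis by (simp add: vec_eq_iff transpose_def)
qed

lemma qf_add:
  assumes "psd R"
  shows "qf R (x + y) = qf R x + 2 * (x \<bullet> (R *v y)) + qf R y"
  using assms sym_inner_commute[of R y x]
  by (simp add: psd_def qf_def mv.add_right inner_add_left inner_add_right)

lemma qf_scaleR: "qf R (c *\<^sub>R x) = c\<^sup>2 * qf R x"
  by (simp add: qf_def mv.scaleR_right power2_eq_square)

lemma qf_minus: "qf R (- x) = qf R x"
  by (simp add: qf_def mv.minus_right)

lemma qf_zero [simp]: "qf R 0 = 0"
  by (simp add: qf_def)

lemma abs_inner_le_qf:
  assumes "psd R"
  shows "2 * \<bar>x \<bullet> (R *v y)\<bar> \<le> qf R x + qf R y"
  using psd_nonneg[OF assms, of "x + y"] psd_nonneg[OF assms, of "x + - y"]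
  unfolding qf_add[OF assms] qf_minus by (simp add: mv.minus_right)

lemma qf_add_le:
  assumes "psd R"
  shows "qf R (x + y) \<le> 2 * qf R x + 2 * qf R y"
  using abs_inner_le_qf[OF assms, of x y] by (simp add: qf_add[OF assms])

lemma qf_sum_le:
  assumes "psd R"
  shows "qf R (\<Sum>j<m. u j) \<le> 2 ^ m * (\<Sum>j<m. qf R (u j))"
proof (induction m)
  case (Suc m)
  have "qf R (\<Sum>j<Suc m. u j) \<le> 2 * qf R (\<Sum>j<m. u j) + 2 * qf R (u m)"
    by (simp add: qf_add_le[OF assms])
  also have "\<dots> \<le> 2 * (2 ^ m * (\<Sum>j<m. qf R (u j))) + 2 ^ Suc m * qf R (u m)"
    using Suc psd_nonneg[OF assms] by (intro add_mono mult_mono mult_left_mono) auto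
  finally show ?case by (simp add: algebra_simps)
qed simp

lemma qf_le_norm: "qf R x \<le> norm R * (norm x)\<^sup>2"
proof -
  have "qf R x \<le> norm x * norm (R *v x)"
    unfolding qf_def by (rule norm_cauchy_schwarz)
  also have "\<dots> \<le> norm x * (norm R * norm x)"
    by (intro mult_left_mono norm_matrix_vector_mult_le) simp
  finally show ?thesis by (simp add: power2_eq_square mult_ac)
qed

text \<open>Nonnegativity of the form at \<open>x - |R|\<^sup>-\<^sup>1 R x\<close>.\<close>

lemma norm_psd_mult_le:
  assumes "psd R"
  shows "(norm (R *v x))\<^sup>2 \<le> norm R * qf R x"
proof (cases "norm R = 0")
  case False
  define r where "r = norm R"
  have r: "r > 0" using False by (simp add: r_def)
  define y where "y = R *v x"
  have "0 \<le> qf R (x + (- (1 / r)) *\<^sub>R y)"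
    by (rule psd_nonneg[OF assms])
  also have "\<dots> = qf R x - 2 / r * (x \<bullet> (R *v y)) + (1 / r)\<^sup>2 * qf R y"
    by (simp only: qf_add[OF assms] qf_scaleR mv.scaleR_right) (simp add: power2_eq_square)
  also have "x \<bullet> (R *v y) = (norm y)\<^sup>2"
    using assms sym_inner_commute[of R x y] by (simp add: psd_def y_def power2_norm_eq_inner)
  also have "(1 / r)\<^sup>2 * qf R y \<le> (1 / r)\<^sup>2 * (r * (norm y)\<^sup>2)"
    unfolding r_def by (intro mult_left_mono qf_le_norm) auto
  finally have "0 \<le> qf R x - 1 / r * (norm y)\<^sup>2"
    using r by (simp add: power2_eq_square field_simps)
  then show ?thesis
    using r by (simp add: field_simps y_def r_def)
qed simp

lemma qf_eq_0_iff:
  assumes "psd R"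
  shows "qf R x = 0 \<longleftrightarrow> R *v x = 0"
  using norm_psd_mult_le[OF assms, of x] by (auto simp: qf_def)

text \<open>If \<open>N x\<close> determines \<open>R B x\<close>, then a linear right inverse of \<open>N\<close> replaces \<open>x\<close> by a vector whose norm
  is controlled by \<open>N x\<close>, and hence by the value of the form \<open>N\<close>.\<close>

lemma qf_dominated:
  fixes R N B :: "real^'n::finite^'n"
  assumes "psd R" "psd N" and ker: "\<And>x. qf N x = 0 \<Longrightarrow> qf R (B *v x) = 0"
  obtains C where "C \<ge> 0" "\<And>x. qf R (B *v x) \<le> C * qf N x"
proof -
  have lin: "linear ((*v) N)" by (rule matrix_vector_mul_linear)
  obtain r where r: "linear r" "\<And>v. v \<in> range ((*v) N) \<Longrightarrow> N *v r v = v"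
    using real_vector.linear_exists_right_inverse_on[OF lin, of UNIV] by auto
  obtain K where K: "\<And>v. norm (r v) \<le> norm v * K" "K > 0"
    using bounded_linear.pos_bounded[of r] r(1) linear_conv_bounded_linear by auto
  define C where "C = norm R * ((norm B)\<^sup>2 * (K\<^sup>2 * norm N))"
  have "qf R (B *v x) \<le> C * qf N x" for x
  proof -
    define x' where "x' = r (N *v x)"
    have "N *v (x - x') = 0"
      using r(2)[of "N *v x"] by (simp add: mv.diff_right x'_def)
    then have "R *v (B *v (x - x')) = 0"
      using ker qf_eq_0_iff assms(1,2) by blast
    then have R: "R *v (B *v x) = R *v (B *v x')"
      by (simp add: mv.diff_right)
    have "qf R (B *v x) = (B *v x) \<bullet> (R *v (B *v x'))"
      by (simp add: qf_def R)
    also have "\<dots> = qf R (B *v x')"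
      using assms(1) sym_inner_commute[of R "B *v x" "B *v x'"] by (simp add: psd_def qf_def R)
    also have "\<dots> \<le> norm R * (norm (B *v x'))\<^sup>2"
      by (rule qf_le_norm)
    also have "\<dots> \<le> norm R * ((norm B)\<^sup>2 * (norm x')\<^sup>2)"
      using norm_matrix_vector_mult_le[of B x']
      by (intro mult_left_mono) (simp_all add: power_mult_distrib[symmetric] power_mono)
    also have "\<dots> \<le> norm R * ((norm B)\<^sup>2 * ((norm (N *v x))\<^sup>2 * K\<^sup>2))"
      using K(1)[of "N *v x"]
      by (intro mult_left_mono) (simp_all add: x'_def power_mult_distrib[symmetric] power_mono)
    also have "\<dots> \<le> norm R * ((norm B)\<^sup>2 * ((norm N * qf N x) * K\<^sup>2))"
      by (intro mult_left_mono mult_right_mono norm_psd_mult_le assms) auto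
    finally show ?thesis by (simp add: C_def mult_ac)
  qed
  moreover have "C \<ge> 0" by (simp add: C_def)
  ultimately show ?thesis by (rule that[rotated])
qed


section \<open>Polynomial curves and perturbed linear flows\<close>

lemma continuous_on_qf:
  assumes "continuous_on S x"
  shows "continuous_on S (\<lambda>s. qf R (x s))"
  unfolding qf_def
  by (intro continuous_on_inner assms bounded_linear.continuous_on[OF matrix_vector_mul_bounded_linear])

lemma integral_power_0:
  fixes t :: real
  assumes "0 \<le> t"
  shows "integral {0..t} (\<lambda>s. s ^ m) = t ^ Suc m / real (Suc m)"
proof -
  have "((\<lambda>s. s ^ Suc m / real (Suc m)) has_real_derivative x ^ m) (at x within {0..t})" for x
    using DERIV_cdivide[OF DERIV_pow[of "Suc m" x "{0..t}"], of "real (Suc m)"] by (simp del: of_nat_Suc power_Suc)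
  then have "((\<lambda>s. s ^ m) has_integral (t ^ Suc m / real (Suc m) - 0 ^ Suc m / real (Suc m))) {0..t}"
    by (intro fundamental_theorem_of_calculus[OF assms])
      (simp add: has_real_derivative_iff_has_vector_derivative del: of_nat_Suc power_Suc)
  then show ?thesis by (intro integral_unique) simp
qed

text \<open>The polynomial curves of bounded degree form a finite-dimensional space, so the integral controls
  all coefficients; the powers of \<open>t\<close> are dictated by scaling. The proof is by induction on the
  degree: \<open>p(2s) - 2\<^sup>m p(s)\<close> has degree below \<open>m\<close> and determines all coefficients of \<open>p\<close> except the one
  of degree \<open>m\<close>, which is then bounded by subtracting the others from \<open>p\<close>.\<close>

lemma qf_polynomial_lower_bound:
  fixes R :: "real^'n::finite^'n"
  assumes R: "psd R"
  shows "\<exists>c>0. \<forall>t>0. \<forall>v. c * (\<Sum>j<Suc k. t ^ (2 * j + 1) * qf R (v j)) \<le>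
    integral {0..t} (\<lambda>s. qf R (\<Sum>j<Suc k. s ^ j *\<^sub>R v j))"
proof (induction k)
  case 0
  show ?case by (intro exI[of _ 1]) auto
next
  case (Suc k)
  then obtain c where c: "c > 0" and IH: "\<And>t v. t > 0 \<Longrightarrow>
      c * (\<Sum>j<Suc k. t ^ (2 * j + 1) * qf R (v j)) \<le>
      integral {0..t} (\<lambda>s. qf R (\<Sum>j<Suc k. s ^ j *\<^sub>R v j))"
    by blast
  define m where "m = Suc k"
  define L where "L = 1 + 2 * 4 ^ m + (1::real)"
  define L' where "L' = L * 2 ^ (2 * m) / c"
  define D where "D = real (2 * m + 1) * (2 + 2 * 2 ^ m * L')"
  have L: "L > 0" by (simp add: L_def add_pos_pos)
  have L': "L' > 0" using L c by (simp add: L'_def)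
  have D: "D \<ge> 0" using L' by (simp add: D_def)
  have main: "(\<Sum>j<Suc m. t ^ (2 * j + 1) * qf R (v j)) \<le>
      (L' + D) * integral {0..t} (\<lambda>s. qf R (\<Sum>j<Suc m. s ^ j *\<^sub>R v j))" if t: "t > 0" for t v
  proof -
    define p where "p s = (\<Sum>j<Suc m. s ^ j *\<^sub>R v j)" for s
    define I where "I = integral {0..t} (\<lambda>s. qf R (p s))"
    define \<Sigma> where "\<Sigma> = (\<Sum>j<m. t ^ (2 * j + 1) * qf R (v j))"
    have cont: "continuous_on S (\<lambda>s. qf R (p (a * s)))" for S a
      unfolding p_def by (intro continuous_on_qf continuous_intros)
    have contp: "continuous_on S (\<lambda>s. qf R (p s))" for S
      using cont[of S 1] by simp
    have int: "(\<lambda>s. qf R (p (a * s))) integrable_on {0..b}" for a b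
      by (intro integrable_continuous_real cont)
    have half: "integral {0..t/2} (\<lambda>s. qf R (p (2 * s))) = I / 2"
    proof -
      have "((\<lambda>s. qf R (p s)) has_integral I) {0..t}"
        unfolding I_def by (intro integrable_integral integrable_continuous_real contp)
      from has_integral_stretch_real[OF this, of 2] show ?thesis
        by (intro integral_unique) simp
    qed
    have sub: "integral {0..t/2} (\<lambda>s. qf R (p s)) \<le> I"
      unfolding I_def using t
      by (intro integral_subset_le integrable_continuous_real contp) (auto simp: psd_nonneg[OF R])
    \<comment> \<open>The coefficients below the leading one, by the induction hypothesis on half of the interval.\<close>
    have low: "\<Sigma> \<le> L' * I"
    proof -
      let ?u = "\<lambda>j. (2 ^ j - 2 ^ m) *\<^sub>R v j"
      have q: "p (2 * s) + (- (2 ^ m)) *\<^sub>R p s = (\<Sum>j<m. s ^ j *\<^sub>R ?u j)" for s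
        by (simp add: p_def scaleR_sum_right sum_negf[symmetric] sum.distrib[symmetric] power_mult_distrib
            scaleR_diff_left algebra_simps flip: sum_subtractf)
      have "\<Sigma> \<le> (\<Sum>j<m. 2 ^ (2 * m) * ((t/2) ^ (2 * j + 1) * qf R (?u j)))"
        unfolding \<Sigma>_def
      proof (intro sum_mono)
        fix j assume "j \<in> {..<m}"
        then have j: "Suc j \<le> m" by simp
        have "2 * (2::real) ^ j \<le> 2 ^ m" using power_increasing[OF j, of "2::real"] by simp
        moreover have "(1::real) \<le> 2 ^ j" by simp
        ultimately have "(2::real) ^ m - 2 ^ j \<ge> 1" by linarith
        then have "(2 ^ m - 2 ^ j)\<^sup>2 \<ge> (1::real)" by simp
        then have 1: "(2 ^ j - 2 ^ m)\<^sup>2 \<ge> (1::real)" by (simp add: power2_commute)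
        have 2: "2 ^ (2 * m) * (t/2) ^ (2 * j + 1) \<ge> t ^ (2 * j + 1)"
        proof -
          have "(2::real) ^ (2 * j + 1) \<le> 2 ^ (2 * m)" using j by (intro power_increasing) auto
          then show ?thesis using t by (simp add: power_divide field_simps)
        qed
        have "t ^ (2 * j + 1) * qf R (v j) \<le> (2 ^ (2 * m) * (t/2) ^ (2 * j + 1)) * ((2 ^ j - 2 ^ m)\<^sup>2 * qf R (v j))"
          using 2 mult_right_mono[OF 1 psd_nonneg[OF R, of "v j"]] t psd_nonneg[OF R, of "v j"]
          by (intro mult_mono) auto
        then show "t ^ (2 * j + 1) * qf R (v j) \<le> 2 ^ (2 * m) * ((t/2) ^ (2 * j + 1) * qf R (?u j))"
          by (simp add: qf_scaleR mult_ac)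
      qed
      also have "\<dots> = (2 ^ (2 * m) / c) * (c * (\<Sum>j<Suc k. (t/2) ^ (2 * j + 1) * qf R (?u j)))"
        unfolding m_def[symmetric] sum_distrib_left[symmetric] using c by simp
      also have "\<dots> \<le> (2 ^ (2 * m) / c) * integral {0..t/2} (\<lambda>s. qf R (\<Sum>j<Suc k. s ^ j *\<^sub>R ?u j))"
        using c t by (intro mult_left_mono IH) auto
      also have "integral {0..t/2} (\<lambda>s. qf R (\<Sum>j<Suc k. s ^ j *\<^sub>R ?u j))
          \<le> integral {0..t/2} (\<lambda>s. 2 * qf R (p (2 * s)) + (2 * 4 ^ m) * qf R (p s))"
      proof (intro integral_le integrable_add integrable_on_mult_right int)
        show "(\<lambda>s. qf R (\<Sum>j<Suc k. s ^ j *\<^sub>R ?u j)) integrable_on {0..t/2}"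
          by (intro integrable_continuous_real continuous_on_qf continuous_intros)
        show "(\<lambda>s. qf R (p s)) integrable_on {0..t/2}" using int[of 1] by simp
        fix s
        have "qf R (p (2 * s) + (- (2 ^ m)) *\<^sub>R p s) \<le> 2 * qf R (p (2 * s)) + 2 * qf R ((- (2 ^ m)) *\<^sub>R p s)"
          by (rule qf_add_le[OF R])
        also have "qf R ((- (2 ^ m)) *\<^sub>R p s) = 4 ^ m * qf R (p s)"
          by (simp only: qf_scaleR) (simp add: power2_eq_square flip: power_mult_distrib)
        finally show "qf R (\<Sum>j<Suc k. s ^ j *\<^sub>R ?u j) \<le> 2 * qf R (p (2 * s)) + (2 * 4 ^ m) * qf R (p s)"
          unfolding q m_def[symmetric] by simp
      qed
      also have "\<dots> = 2 * integral {0..t/2} (\<lambda>s. qf R (p (2 * s))) + (2 * 4 ^ m) * integral {0..t/2} (\<lambda>s. qf R (p s))"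
        using int[of 1] by (subst integral_add) (auto intro!: integrable_on_mult_right int)
      also have "\<dots> \<le> 2 * (I / 2) + (2 * 4 ^ m) * I"
        unfolding half by (intro add_mono mult_left_mono sub) auto
      also have "\<dots> \<le> L * I"
      proof -
        have "0 \<le> I" unfolding I_def by (intro integral_nonneg) (use int[of 1] psd_nonneg[OF R] in auto)
        then show ?thesis by (simp add: L_def algebra_simps)
      qed
      finally show ?thesis
        using c by (simp add: L'_def divide_right_mono mult_ac)
    qed
    \<comment> \<open>The leading coefficient, from what is left of the curve.\<close>
    have top: "t ^ (2 * m + 1) * qf R (v m) \<le> D * I"
    proof -
      have pt: "s ^ (2 * m) * qf R (v m) \<le> 2 * qf R (p s) + (2 * 2 ^ m) * (\<Sum>j<m. t ^ (2 * j) * qf R (v j))"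
        if s: "s \<in> {0..t}" for s
      proof -
        have "qf R (s ^ m *\<^sub>R v m) = qf R (p s + - (\<Sum>j<m. s ^ j *\<^sub>R v j))"
          by (simp add: p_def)
        also have "\<dots> \<le> 2 * qf R (p s) + 2 * qf R (\<Sum>j<m. s ^ j *\<^sub>R v j)"
          using qf_add_le[OF R, of "p s" "- (\<Sum>j<m. s ^ j *\<^sub>R v j)"] by (simp add: qf_minus)
        also have "qf R (\<Sum>j<m. s ^ j *\<^sub>R v j) \<le> 2 ^ m * (\<Sum>j<m. qf R (s ^ j *\<^sub>R v j))"
          by (rule qf_sum_le[OF R])
        also have "(\<Sum>j<m. qf R (s ^ j *\<^sub>R v j)) \<le> (\<Sum>j<m. t ^ (2 * j) * qf R (v j))"
          using s by (intro sum_mono)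
            (auto simp: qf_scaleR mult.commute power_mult[symmetric] intro!: mult_left_mono mult_right_mono power_mono psd_nonneg[OF R])
        finally show ?thesis
          by (simp add: qf_scaleR power_mult[symmetric] mult.commute[of m])
      qed
      have "t ^ (2 * m + 1) / real (2 * m + 1) * qf R (v m) = integral {0..t} (\<lambda>s. s ^ (2 * m) * qf R (v m))"
        using integral_power_0[of t "2 * m"] t by simp
      also have "\<dots> \<le> integral {0..t} (\<lambda>s. 2 * qf R (p s) + (2 * 2 ^ m) * (\<Sum>j<m. t ^ (2 * j) * qf R (v j)))"
        by (intro integral_le integrable_continuous_real continuous_intros contp pt)
      also have "\<dots> = 2 * I + integral {0..t} (\<lambda>s. (2 * 2 ^ m) * (\<Sum>j<m. t ^ (2 * j) * qf R (v j)))"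
        unfolding I_def using int[of 1 t]
        by (subst integral_add) (auto intro!: integrable_on_mult_right)
      also have "integral {0..t} (\<lambda>s. (2 * 2 ^ m) * (\<Sum>j<m. t ^ (2 * j) * qf R (v j))) = (2 * 2 ^ m) * \<Sigma>"
        using t by (simp add: \<Sigma>_def sum_distrib_left mult_ac)
      also have "\<dots> \<le> (2 * 2 ^ m) * (L' * I)"
        by (intro mult_left_mono low) auto
      finally show ?thesis
        by (simp add: D_def field_simps)
    qed
    show ?thesis
      using low top unfolding \<Sigma>_def I_def p_def by (simp add: algebra_simps)
  qed
  have "L' + D > 0" using L' D by simp
  then show ?case
    using main unfolding m_def
    by (intro exI[of _ "1 / (L' + D)"]) (auto simp: field_simps m_def)
qed


lemma gronwall_from_zero:
  fixes n h :: "real \<Rightarrow> real"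
  assumes n: "\<And>s. s \<in> {0..t} \<Longrightarrow> (n has_vector_derivative n' s) (at s within {0..t})"
    and le: "\<And>s. s \<in> {0..t} \<Longrightarrow> n' s \<le> K * n s + h s"
    and h: "continuous_on {0..t} h" "\<And>s. s \<in> {0..t} \<Longrightarrow> 0 \<le> h s"
    and "n 0 = 0" "0 \<le> K" "s \<in> {0..t}"
  shows "n s \<le> exp (K * t) * integral {0..t} h"
proof -
  define m where "m r = exp (- (K * r)) * n r" for r
  have "(m has_vector_derivative exp (- (K * r)) * (n' r - K * n r)) (at r within {0..s})"
    if "r \<in> {0..s}" for r
  proof -
    have "(n has_real_derivative n' r) (at r within {0..s})"
      using has_vector_derivative_within_subset[OF n[of r]] that assms(7)
      by (auto simp: has_real_derivative_iff_has_vector_derivative)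
    then have "(m has_real_derivative exp (- (K * r)) * (n' r - K * n r)) (at r within {0..s})"
      unfolding m_def by (auto intro!: derivative_eq_intros simp: algebra_simps)
    then show ?thesis
      by (simp add: has_real_derivative_iff_has_vector_derivative)
  qed
  then have "((\<lambda>r. exp (- (K * r)) * (n' r - K * n r)) has_integral (m s - m 0)) {0..s}"
    using assms(7) by (intro fundamental_theorem_of_calculus) auto
  moreover have hint: "h integrable_on {0..s}"
    using assms(7) by (intro integrable_continuous_real continuous_on_subset[OF h(1)]) auto
  ultimately have "m s - m 0 \<le> integral {0..s} h"
  proof (rule has_integral_le[OF _ integrable_integral])
    fix r assume r: "r \<in> {0..s}"
    then have r': "r \<in> {0..t}" using assms(7) by auto
    have "exp (- (K * r)) * (n' r - K * n r) \<le> exp (- (K * r)) * h r"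
      using le[OF r'] by (intro mult_left_mono) auto
    also have "\<dots> \<le> 1 * h r"
      using r h(2)[OF r'] assms(6) by (intro mult_right_mono) auto
    finally show "exp (- (K * r)) * (n' r - K * n r) \<le> h r" by simp
  qed
  also have "integral {0..s} h \<le> integral {0..t} h"
    using assms(7) h(2) by (intro integral_subset_le hint integrable_continuous_real h(1)) auto
  finally have m: "m s \<le> integral {0..t} h"
    using assms(5) by (simp add: m_def)
  have "n s = exp (K * s) * m s"
    by (simp add: m_def mult.assoc[symmetric] exp_add[symmetric])
  also have "\<dots> \<le> exp (K * s) * integral {0..t} h"
    by (intro mult_left_mono m) simp
  also have "\<dots> \<le> exp (K * t) * integral {0..t} h"
    using assms(6,7) integral_nonneg[OF integrable_continuous_real[OF h(1)] h(2)]
    by (intro mult_right_mono) (auto intro: mult_left_mono)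
  finally show ?thesis .
qed

lemma has_vector_derivative_qf:
  assumes "psd R" "(x has_vector_derivative x') (at s within S)"
  shows "((\<lambda>s. qf R (x s)) has_vector_derivative 2 * (x s \<bullet> (R *v x'))) (at s within S)"
proof -
  have "((\<lambda>s. R *v x s) has_vector_derivative R *v x') (at s within S)"
    by (rule bounded_linear.has_vector_derivative[OF matrix_vector_mul_bounded_linear assms(2)])
  from bounded_bilinear.has_vector_derivative[OF bounded_bilinear_inner assms(2) this]
  show ?thesis
    using sym_inner_commute[of R x' "x s"] assms(1) by (simp add: qf_def psd_def)
qed

lemma qf_sum_matrix:
  fixes m :: nat
  shows "qf (\<Sum>j<m. G j) x = (\<Sum>j<m. qf (G j) x)"
  by (induction m) (simp_all add: qf_def mv.add_left inner_add_right)

lemma qf_congruence: "qf (transpose B ** R ** B) x = qf R (B *v x)"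
proof -
  have "x \<bullet> (transpose B *v (R *v (B *v x))) = (B *v x) \<bullet> (R *v (B *v x))"
    using inner_matrix_transpose[of x "transpose B" "R *v (B *v x)"] by (simp del: transpose_matrix_vector)
  then show ?thesis
    by (simp add: qf_def matrix_vector_mul_assoc[symmetric] del: transpose_matrix_vector)
qed

lemma has_vector_derivative_exp_taylor:
  fixes A :: "real^'n::finite^'n"
  shows "((\<lambda>s. \<Sum>j<Suc k. (s ^ j / fact j) *\<^sub>R (matrix_pow A j *v X)) has_vector_derivative
    (A *v (\<Sum>j<Suc k. (s ^ j / fact j) *\<^sub>R (matrix_pow A j *v X))
      - (s ^ k / fact k) *\<^sub>R (matrix_pow A (Suc k) *v X))) (at s within S)"
proof (induction k)
  case 0
  show ?case by (simp add: has_vector_derivative_const)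
next
  case (Suc k)
  have "real (Suc k) * s ^ k / fact (Suc k) = s ^ k / fact k"
    by (simp del: of_nat_Suc)
  then have "((\<lambda>s::real. s ^ Suc k / fact (Suc k)) has_real_derivative s ^ k / fact k) (at s within S)"
    using DERIV_cdivide[OF DERIV_pow[of "Suc k" s S], of "fact (Suc k)"]
    by (simp del: power_Suc fact_Suc of_nat_Suc)
  then have "((\<lambda>s. (s ^ Suc k / fact (Suc k)) *\<^sub>R (matrix_pow A (Suc k) *v X)) has_vector_derivative
      (s ^ k / fact k) *\<^sub>R (matrix_pow A (Suc k) *v X)) (at s within S)"
    unfolding has_real_derivative_iff_has_vector_derivative
    by (rule bounded_linear.has_vector_derivative[OF bounded_linear_scaleR_left])
  from has_vector_derivative_add[OF Suc this] show ?case
    by (simp add: mv.add_right mv.scaleR_right matrix_vector_mul_assoc matrix_mul_assoc del: power_Suc fact_Suc)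
qed

text \<open>Observability of a linear flow through the form \<open>R\<close>, stable under perturbations that pass through
  \<open>R\<close>. Iterates \<open>A\<^sup>j X\<close> with \<open>j > k\<close> carry no further information by the hypothesis on the
  kernels, and this is what allows the Taylor remainder and the perturbation to be estimated in
  the degenerate form \<open>N\<close> rather than in the norm of \<open>X\<close>, which \<open>N\<close> does not bound.\<close>

lemma perturbed_flow_lower_bound:
  fixes R A E :: "real^'n::finite^'n"
  assumes R: "psd R"
    and ker: "\<And>x m. (\<And>j. j \<le> k \<Longrightarrow> qf R (matrix_pow A j *v x) = 0) \<Longrightarrow> qf R (matrix_pow A m *v x) = 0"
  shows "\<exists>T c. 0 < T \<and> T < 1 \<and> 0 < c \<and> (\<forall>t x y. 0 < t \<and> t \<le> T \<and>
      (\<forall>s\<in>{0..t}. (x has_vector_derivative A *v x s + E *v (R *v y s)) (at s within {0..t})) \<and>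
      continuous_on {0..t} y \<longrightarrow>
      c * (\<Sum>j<Suc k. t ^ (2 * j + 1) * qf R (matrix_pow A j *v x 0)) \<le>
        integral {0..t} (\<lambda>s. qf R (x s) + qf R (y s)))"
proof -
  define N where "N = (\<Sum>j<Suc k. transpose (matrix_pow A j) ** R ** matrix_pow A j)"
  have qN: "qf N x = (\<Sum>j<Suc k. qf R (matrix_pow A j *v x))" for x
    unfolding N_def qf_sum_matrix qf_congruence ..
  have tr: "transpose (\<Sum>j<m. transpose (matrix_pow A j) ** R ** matrix_pow A j) =
      (\<Sum>j<m. transpose (matrix_pow A j) ** R ** matrix_pow A j)" for m
  proof (induction m)
    case (Suc m)
    have "transpose (transpose (matrix_pow A m) ** R ** matrix_pow A m) = transpose (matrix_pow A m) ** R ** matrix_pow A m"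
      using R by (simp add: psd_def matrix_transpose_mul matrix_mul_assoc)
    moreover have "transpose (P + Q) = transpose P + transpose Q" for P Q :: "real^'n^'n"
      by (simp add: vec_eq_iff transpose_def)
    ultimately show ?case using Suc by simp
  qed (simp add: vec_eq_iff transpose_def)
  have "transpose N = N"
    unfolding N_def by (rule tr)
  then have N: "psd N"
    unfolding psd_def qN using psd_nonneg[OF R] by (auto intro!: sum_nonneg simp del: sum.lessThan_Suc)
  have RN: "qf R x \<le> qf N x" for x
  proof -
    have "qf R (matrix_pow A 0 *v x) \<le> qf N x"
      unfolding qN using psd_nonneg[OF R] by (intro member_le_sum) auto
    then show ?thesis by simp
  qed
  have kerN: "qf N (matrix_pow A m *v x) = 0" if "qf N x = 0" for m x
  proof -
    have "qf R (matrix_pow A j *v x) = 0" if "j \<le> k" for j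
      using \<open>qf N x = 0\<close> that psd_nonneg[OF R] unfolding qN
      by (auto simp: sum_nonneg_eq_0_iff simp del: sum.lessThan_Suc)
    then have "qf R (matrix_pow A (j + m) *v x) = 0" for j
      by (rule ker)
    then show ?thesis
      unfolding qN by (simp add: matrix_pow_add matrix_vector_mul_assoc)
  qed
  obtain C1 where C1: "C1 \<ge> 0" "\<And>x. qf N (A *v x) \<le> C1 * qf N x"
    using qf_dominated[OF N N, of A] kerN[of _ 1] by auto
  obtain C3 where C3: "C3 \<ge> 0" "\<And>x. qf N (matrix_pow A (Suc k) *v x) \<le> C3 * qf N x"
    using qf_dominated[OF N N, of "matrix_pow A (Suc k)"] kerN[of _ "Suc k"] by auto
  define C2 where "C2 = norm N * ((norm E)\<^sup>2 * norm R)"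
  have C2: "C2 \<ge> 0" "qf N (E *v (R *v y)) \<le> C2 * qf R y" for y
  proof -
    have "qf N (E *v (R *v y)) \<le> norm N * (norm (E *v (R *v y)))\<^sup>2"
      by (rule qf_le_norm)
    also have "\<dots> \<le> norm N * ((norm E)\<^sup>2 * (norm (R *v y))\<^sup>2)"
      using norm_matrix_vector_mult_le[of E "R *v y"]
      by (intro mult_left_mono) (simp_all add: power_mult_distrib[symmetric] power_mono)
    also have "\<dots> \<le> norm N * ((norm E)\<^sup>2 * (norm R * qf R y))"
      by (intro mult_left_mono norm_psd_mult_le R) auto
    finally show "qf N (E *v (R *v y)) \<le> C2 * qf R y" by (simp add: C2_def mult_ac)
  qed (simp add: C2_def)
  obtain c0 where c0: "c0 > 0" and poly: "\<And>t v. t > 0 \<Longrightarrow>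
      c0 * (\<Sum>j<Suc k. t ^ (2 * j + 1) * qf R (v j)) \<le>
      integral {0..t} (\<lambda>s. qf R (\<Sum>j<Suc k. s ^ j *\<^sub>R v j))"
    using qf_polynomial_lower_bound[OF R, of k] by blast
  define c1 where "c1 = c0 / (fact k)\<^sup>2"
  define K where "K = 1 + 2 * C1"
  have c1: "c1 > 0" using c0 by (simp add: c1_def)
  have K: "K \<ge> 0" using C1 by (simp add: K_def)
  \<comment> \<open>Small enough for the error terms to be absorbed: the one in \<open>y\<close> by the energy, the one in \<open>\<Sigma>\<close> by the left-hand side.\<close>
  define T where "T = min (1/2) (min (1 / (4 * exp K * C2 + 1)) (c1 / (16 * exp K * C3 + 1)))"
  have T: "0 < T" "T < 1" "T * (4 * exp K * C2) \<le> 1" "T * (8 * exp K * C3) \<le> c1 / 2"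
  proof -
    have p: "0 < 4 * exp K * C2 + 1" "0 < 16 * exp K * C3 + 1"
      using C2 C3 by (auto intro!: add_nonneg_pos)
    show "0 < T" "T < 1" using p c1 by (auto simp: T_def)
    have "T * (4 * exp K * C2 + 1) \<le> 1"
    proof -
      have "T \<le> 1 / (4 * exp K * C2 + 1)" by (simp add: T_def)
      then show ?thesis using p(1) by (simp add: pos_le_divide_eq)
    qed
    then show "T * (4 * exp K * C2) \<le> 1" using \<open>0 < T\<close> by (simp add: algebra_simps)
    have "T * (16 * exp K * C3 + 1) \<le> c1"
    proof -
      have "T \<le> c1 / (16 * exp K * C3 + 1)" by (simp add: T_def)
      then show ?thesis using p(2) by (simp add: pos_le_divide_eq)
    qed
    then show "T * (8 * exp K * C3) \<le> c1 / 2" using \<open>0 < T\<close> by (simp add: algebra_simps)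
  qed
  have main: "c1 / 4 * (\<Sum>j<Suc k. t ^ (2 * j + 1) * qf R (matrix_pow A j *v x 0)) \<le>
        integral {0..t} (\<lambda>s. qf R (x s) + qf R (y s))"
    if t: "0 < t" "t \<le> T"
      and x: "\<And>s. s \<in> {0..t} \<Longrightarrow> (x has_vector_derivative A *v x s + E *v (R *v y s)) (at s within {0..t})"
      and y: "continuous_on {0..t} y" for t x y
  proof -
    define X where "X = x 0"
    define \<Sigma> where "\<Sigma> = (\<Sum>j<Suc k. t ^ (2 * j + 1) * qf R (matrix_pow A j *v X))"
    \<comment> \<open>The Taylor polynomial of the unperturbed solution; it solves the equation up to the error \<open>e\<close>.\<close>
    define z where "z s = (\<Sum>j<Suc k. (s ^ j / fact j) *\<^sub>R (matrix_pow A j *v X))" for s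
    define d where "d s = x s - z s" for s
    define e where "e s = (s ^ k / fact k) *\<^sub>R (matrix_pow A (Suc k) *v X)" for s
    define h where "h s = 4 * C2 * qf R (y s) + 4 * C3 * t ^ (2 * k) * qf N X" for s
    have t1: "t \<le> 1" using t T by simp
    have contx: "continuous_on {0..t} x"
      unfolding continuous_on_eq_continuous_within
      using has_vector_derivative_continuous[OF x] by blast
    have contz: "continuous_on {0..t} z"
      unfolding z_def by (intro continuous_intros) auto
    have contd: "continuous_on {0..t} d"
      unfolding d_def by (intro continuous_intros contx contz)
    note int = integrable_continuous_real[OF continuous_on_qf[OF contx]]
      integrable_continuous_real[OF continuous_on_qf[OF y]]
      integrable_continuous_real[OF continuous_on_qf[OF contz]]
      integrable_continuous_real[OF continuous_on_qf[OF contd]]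
    have d: "(d has_vector_derivative (A *v d s + (E *v (R *v y s) + e s))) (at s within {0..t})"
      if "s \<in> {0..t}" for s
    proof -
      have "(z has_vector_derivative A *v z s - e s) (at s within {0..t})"
        unfolding z_def e_def by (rule has_vector_derivative_exp_taylor)
      from has_vector_derivative_diff[OF x[OF that] this] show ?thesis
        unfolding d_def by (simp add: mv.diff_right algebra_simps)
    qed
    have nd: "qf N (d s) \<le> exp (K * t) * integral {0..t} h" if "s \<in> {0..t}" for s
    proof (rule gronwall_from_zero[OF has_vector_derivative_qf[OF N d] _ _ _ _ K that])
      show "continuous_on {0..t} h"
        unfolding h_def by (intro continuous_intros continuous_on_qf y)
      show "0 \<le> h s" for s
        unfolding h_def using C2 C3 t psd_nonneg[OF R] psd_nonneg[OF N] by simp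
      have "z 0 = X"
        unfolding z_def by (subst sum.lessThan_Suc_shift) simp
      then show "qf N (d 0) = 0" by (simp add: d_def X_def)
      fix s assume s: "s \<in> {0..t}"
      have "2 * (d s \<bullet> (N *v (A *v d s + (E *v (R *v y s) + e s))))
          \<le> qf N (d s) + qf N (A *v d s + (E *v (R *v y s) + e s))"
        using abs_inner_le_qf[OF N, of "d s" "A *v d s + (E *v (R *v y s) + e s)"] by linarith
      also have "\<dots> \<le> qf N (d s) + (2 * qf N (A *v d s) + 2 * (2 * qf N (E *v (R *v y s)) + 2 * qf N (e s)))"
        by (intro add_left_mono order_trans[OF qf_add_le[OF N]] mult_left_mono qf_add_le[OF N]) auto
      also have "\<dots> \<le> qf N (d s) + (2 * (C1 * qf N (d s)) + 2 * (2 * (C2 * qf R (y s)) + 2 * (t ^ (2 * k) * (C3 * qf N X))))"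
      proof -
        have "qf N (e s) = (s ^ k / fact k)\<^sup>2 * qf N (matrix_pow A (Suc k) *v X)"
          unfolding e_def by (rule qf_scaleR)
        also have "\<dots> \<le> t ^ (2 * k) * (C3 * qf N X)"
        proof (intro mult_mono C3)
          have "s ^ k / fact k \<le> t ^ k / 1"
            using s by (intro frac_le power_mono) (auto simp: fact_ge_1)
          then have "(s ^ k / fact k)\<^sup>2 \<le> (t ^ k)\<^sup>2"
            using s by (intro power_mono) auto
          then show "(s ^ k / fact k)\<^sup>2 \<le> t ^ (2 * k)"
            by (simp add: power_mult[symmetric] mult.commute)
        qed (use t psd_nonneg[OF N] in auto)
        finally show ?thesis
          by (intro add_left_mono add_mono mult_left_mono C1(2) C2(2)) simp_all
      qed
      also have "\<dots> = K * qf N (d s) + h s"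
        by (simp add: K_def h_def algebra_simps)
      finally show "2 * (d s \<bullet> (N *v (A *v d s + (E *v (R *v y s) + e s)))) \<le> K * qf N (d s) + h s" .
    qed
    have Iy: "0 \<le> integral {0..t} (\<lambda>s. qf R (y s))" and Ix: "0 \<le> integral {0..t} (\<lambda>s. qf R (x s))"
      using psd_nonneg[OF R] by (auto intro!: integral_nonneg int)
    have \<Sigma>0: "0 \<le> \<Sigma>"
      unfolding \<Sigma>_def using t psd_nonneg[OF R] by (intro sum_nonneg) auto
    have inth: "integral {0..t} h \<le> 4 * C2 * integral {0..t} (\<lambda>s. qf R (y s)) + 4 * C3 * \<Sigma>"
    proof -
      have "integral {0..t} h = 4 * C2 * integral {0..t} (\<lambda>s. qf R (y s)) + t * (4 * C3 * t ^ (2 * k) * qf N X)"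
        unfolding h_def using t by (subst integral_add) (auto intro!: integrable_on_mult_right int)
      also have "t * (4 * C3 * t ^ (2 * k) * qf N X) = 4 * C3 * (\<Sum>j<Suc k. t ^ (2 * k + 1) * qf R (matrix_pow A j *v X))"
        by (simp add: qN sum_distrib_left mult_ac del: sum.lessThan_Suc)
      also have "\<dots> \<le> 4 * C3 * \<Sigma>"
        unfolding \<Sigma>_def using t t1 psd_nonneg[OF R] C3(1)
        by (intro mult_left_mono sum_mono mult_right_mono power_decreasing) auto
      finally show ?thesis by simp
    qed
    have nd': "qf R (d s) \<le> exp K * (4 * C2 * integral {0..t} (\<lambda>s. qf R (y s)) + 4 * C3 * \<Sigma>)"
      if "s \<in> {0..t}" for s
    proof -
      have "qf R (d s) \<le> exp (K * t) * integral {0..t} h"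
        using RN nd[OF that] by (rule order_trans)
      also have "\<dots> \<le> exp (K * t) * (4 * C2 * integral {0..t} (\<lambda>s. qf R (y s)) + 4 * C3 * \<Sigma>)"
        by (intro mult_left_mono inth) simp
      also have "\<dots> \<le> exp K * (4 * C2 * integral {0..t} (\<lambda>s. qf R (y s)) + 4 * C3 * \<Sigma>)"
        using \<Sigma>0 Iy C2(1) C3(1) mult_left_mono[OF t1 K] by (intro mult_right_mono) auto
      finally show ?thesis .
    qed
    have "c1 * \<Sigma> \<le> integral {0..t} (\<lambda>s. qf R (z s))"
    proof -
      have "c1 * \<Sigma> \<le> c0 * (\<Sum>j<Suc k. t ^ (2 * j + 1) * qf R ((1 / fact j) *\<^sub>R (matrix_pow A j *v X)))"
        unfolding \<Sigma>_def c1_def sum_distrib_left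
      proof (intro sum_mono)
        fix j assume "j \<in> {..<Suc k}"
        then have "(fact j)\<^sup>2 \<le> ((fact k)\<^sup>2 :: real)"
          by (intro power_mono fact_mono) auto
        then have "c0 / (fact k)\<^sup>2 \<le> c0 / (fact j)\<^sup>2"
          using c0 by (intro divide_left_mono) auto
        then have "c0 / (fact k)\<^sup>2 * (t ^ (2 * j + 1) * qf R (matrix_pow A j *v X))
            \<le> c0 / (fact j)\<^sup>2 * (t ^ (2 * j + 1) * qf R (matrix_pow A j *v X))"
          using t psd_nonneg[OF R] by (intro mult_right_mono) auto
        then show "c0 / (fact k)\<^sup>2 * (t ^ (2 * j + 1) * qf R (matrix_pow A j *v X))
            \<le> c0 * (t ^ (2 * j + 1) * qf R ((1 / fact j) *\<^sub>R (matrix_pow A j *v X)))"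
          by (simp add: qf_scaleR power_divide mult_ac)
      qed
      also have "\<dots> \<le> integral {0..t} (\<lambda>s. qf R (\<Sum>j<Suc k. s ^ j *\<^sub>R ((1 / fact j) *\<^sub>R (matrix_pow A j *v X))))"
        by (rule poly[OF t(1)])
      finally show ?thesis
        by (simp add: z_def del: sum.lessThan_Suc)
    qed
    also have "\<dots> \<le> integral {0..t} (\<lambda>s. 2 * qf R (x s) +
        2 * (exp K * (4 * C2 * integral {0..t} (\<lambda>s. qf R (y s)) + 4 * C3 * \<Sigma>)))"
    proof (intro integral_le int integrable_add integrable_on_mult_right integrable_const_ivl)
      fix s assume s: "s \<in> {0..t}"
      have "qf R (z s) \<le> 2 * qf R (x s) + 2 * qf R (- d s)"
        using qf_add_le[OF R, of "x s" "- d s"] by (simp add: d_def)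
      then show "qf R (z s) \<le> 2 * qf R (x s) +
          2 * (exp K * (4 * C2 * integral {0..t} (\<lambda>s. qf R (y s)) + 4 * C3 * \<Sigma>))"
        using nd'[OF s] by (simp add: qf_minus)
    qed
    also have "\<dots> = 2 * integral {0..t} (\<lambda>s. qf R (x s)) +
        t * (2 * (exp K * (4 * C2 * integral {0..t} (\<lambda>s. qf R (y s)) + 4 * C3 * \<Sigma>)))"
      using t by (subst integral_add) (auto intro!: integrable_on_mult_right int)
    also have "\<dots> = 2 * integral {0..t} (\<lambda>s. qf R (x s)) +
        (2 * (t * (4 * exp K * C2)) * integral {0..t} (\<lambda>s. qf R (y s)) + t * (8 * exp K * C3) * \<Sigma>)"
      by (simp add: algebra_simps)
    also have "\<dots> \<le> 2 * integral {0..t} (\<lambda>s. qf R (x s)) +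
        (2 * 1 * integral {0..t} (\<lambda>s. qf R (y s)) + c1 / 2 * \<Sigma>)"
    proof (intro add_mono order_refl mult_right_mono mult_left_mono Iy \<Sigma>0)
      show "t * (4 * exp K * C2) \<le> 1"
        by (rule order_trans[OF mult_right_mono[OF t(2)] T(3)]) (use C2(1) in simp)
      show "t * (8 * exp K * C3) \<le> c1 / 2"
        by (rule order_trans[OF mult_right_mono[OF t(2)] T(4)]) (use C3(1) in simp)
    qed auto
    finally have "c1 / 4 * \<Sigma> \<le> integral {0..t} (\<lambda>s. qf R (x s)) + integral {0..t} (\<lambda>s. qf R (y s))"
      by simp
    also have "\<dots> = integral {0..t} (\<lambda>s. qf R (x s) + qf R (y s))"
      by (subst integral_add) (auto intro!: int)
    finally show ?thesis by (simp add: \<Sigma>_def X_def)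
  qed
  show ?thesis
  proof (rule exI[of _ T], rule exI[of _ "c1 / 4"], intro conjI allI impI T(1,2))
    show "0 < c1 / 4" using c1 by simp
  next
    fix t x y
    assume a: "0 < t \<and> t \<le> T \<and>
      (\<forall>s\<in>{0..t}. (x has_vector_derivative A *v x s + E *v (R *v y s)) (at s within {0..t})) \<and>
      continuous_on {0..t} y"
    show "c1 / 4 * (\<Sum>j<Suc k. t ^ (2 * j + 1) * qf R (matrix_pow A j *v x 0)) \<le>
        integral {0..t} (\<lambda>s. qf R (x s) + qf R (y s))"
      by (rule main[OF conjunct1[OF a] conjunct1[OF conjunct2[OF a]]
            bspec[OF conjunct1[OF conjunct2[OF conjunct2[OF a]]]]
            conjunct2[OF conjunct2[OF conjunct2[OF a]]]])
  qed
qed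


section \<open>The symplectic matrix and complexification\<close>

lemma sum_UNIV_sum:
  "(\<Sum>j\<in>(UNIV :: ('a::finite + 'b::finite) set). f j) = (\<Sum>a\<in>UNIV. f (Inl a)) + (\<Sum>b\<in>UNIV. f (Inr b))"
  using sum.Plus[of UNIV UNIV f] by (simp add: o_def)

lemma symplectic_J_mult_nth:
  fixes A :: "'a::comm_ring_1^'m::finite^('n::finite + 'n)"
  shows "(symplectic_J ** A) $ Inl a $ k = A $ Inr a $ k" "(symplectic_J ** A) $ Inr a $ k = - A $ Inl a $ k"
  by (simp_all add: matrix_matrix_mult_def symplectic_J_def sum_UNIV_sum if_distrib[of "\<lambda>x. x * _"] cong: if_cong)

lemma symplectic_J_J_mult:
  fixes A :: "'a::comm_ring_1^'m::finite^('n::finite + 'n)"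
  shows "symplectic_J ** (symplectic_J ** A) = - A"
proof -
  have "(symplectic_J ** (symplectic_J ** A)) $ i $ k = (- A) $ i $ k" for i k
    by (cases i) (simp_all add: symplectic_J_mult_nth)
  then show ?thesis by (simp add: vec_eq_iff)
qed

lemma symplectic_J_square: "symplectic_J ** symplectic_J = (- mat 1 :: 'a::comm_ring_1^('n::finite + 'n)^('n + 'n))"
  using symplectic_J_J_mult[of "mat 1"] by simp

lemma transpose_symplectic_J: "transpose symplectic_J = (- symplectic_J :: 'a::comm_ring_1^('n::finite + 'n)^('n + 'n))"
proof -
  have "transpose symplectic_J $ i $ j = (- symplectic_J :: 'a^('n + 'n)^('n + 'n)) $ i $ j" for i j
    by (cases i; cases j) (simp_all add: transpose_def symplectic_J_def)
  then show ?thesis by (simp add: vec_eq_iff)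
qed

lemma symplectic_J_J_vec:
  fixes x :: "real^('n::finite + 'n)"
  shows "symplectic_J *v (symplectic_J *v x) = - x"
  by (simp add: matrix_vector_mul_assoc symplectic_J_square mv.minus_left)

lemma inner_symplectic_J:
  fixes x y :: "real^('n::finite + 'n)"
  shows "x \<bullet> (symplectic_J *v y) = - ((symplectic_J *v x) \<bullet> y)"
  by (simp only: inner_matrix_transpose[of x symplectic_J y] transpose_symplectic_J mv.minus_left inner_minus_left)

lemma inner_symplectic_J_J:
  fixes x y :: "real^('n::finite + 'n)"
  shows "(symplectic_J *v x) \<bullet> (symplectic_J *v y) = x \<bullet> y"
  by (simp add: inner_symplectic_J symplectic_J_J_vec)

definition complex_mat :: "real^'n::finite^'m::finite \<Rightarrow> complex^'n^'m" where
  "complex_mat = map_matrix complex_of_real"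

lemma complex_mat_nth [simp]: "complex_mat A $ i $ j = of_real (A $ i $ j)"
  by (simp add: complex_mat_def)

lemma complex_mat_mult: "complex_mat (A ** B) = complex_mat A ** complex_mat B"
  by (simp add: vec_eq_iff matrix_matrix_mult_def)

lemma complex_mat_1 [simp]: "complex_mat (mat 1) = mat 1"
  by (simp add: vec_eq_iff mat_def)

lemma complex_mat_symplectic_J:
  "complex_mat symplectic_J = (symplectic_J :: complex^('n::finite + 'n)^('n + 'n))"
proof -
  have "complex_mat symplectic_J $ i $ j = (symplectic_J :: complex^('n + 'n)^('n + 'n)) $ i $ j"
    for i j
    by (cases i; cases j) (simp_all add: symplectic_J_def)
  then show ?thesis by (simp add: vec_eq_iff)
qed

lemma complex_mat_pow: "complex_mat (matrix_pow A k) = matrix_pow (complex_mat A) k"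
  by (induction k) (simp_all add: complex_mat_mult)

text \<open>Left multiplication by \<open>mat z\<close> serves as the multiplication by a complex scalar.\<close>

lemma complex_matrix_eq: "A = complex_mat (Re_matrix A) + mat \<i> ** complex_mat (Im_matrix A)"
  by (simp add: vec_eq_iff mat_mult_nth complex_eq_iff)

lemma cnj_matrix_eq: "map_matrix cnj A = complex_mat (Re_matrix A) - mat \<i> ** complex_mat (Im_matrix A)"
  by (simp add: vec_eq_iff mat_mult_nth complex_eq_iff)

lemma Re_Im_matrix_mult:
  "Re_matrix (A ** B) = Re_matrix A ** Re_matrix B - Im_matrix A ** Im_matrix B"
  "Im_matrix (A ** B) = Re_matrix A ** Im_matrix B + Im_matrix A ** Re_matrix B"
  by (simp_all add: vec_eq_iff matrix_matrix_mult_def sum_subtractf sum.distrib)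

lemma Re_Im_symplectic_J:
  "Re_matrix symplectic_J = (symplectic_J :: real^('n::finite + 'n)^('n + 'n))"
  "Im_matrix symplectic_J = (0 :: real^('n::finite + 'n)^('n + 'n))"
proof -
  have "Re_matrix symplectic_J $ i $ j = (symplectic_J :: real^('n::finite + 'n)^('n + 'n)) $ i $ j"
    "Im_matrix symplectic_J $ i $ j = (0 :: real^('n::finite + 'n)^('n + 'n)) $ i $ j" for i j
    by (cases i; cases j; simp add: symplectic_J_def)+
  then show "Re_matrix symplectic_J = (symplectic_J :: real^('n::finite + 'n)^('n + 'n))"
    "Im_matrix symplectic_J = (0 :: real^('n::finite + 'n)^('n + 'n))"
    by (simp_all add: vec_eq_iff)
qed

lemma Re_Im_hamilton_map:
  "Re_matrix (hamilton_map Q) = symplectic_J ** Re_matrix Q"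
  "Im_matrix (hamilton_map Q) = symplectic_J ** Im_matrix Q"
  by (simp_all add: hamilton_map_def Re_Im_matrix_mult Re_Im_symplectic_J)

lemma norm_mat_i_complex_mat:
  fixes A :: "real^'n::finite^'n"
  shows "norm (mat \<i> ** complex_mat A) = norm A"
  by (simp add: norm_vec_def mat_mult_nth norm_mult)

lemma quad_form_mat_mult: "quad_form (mat z ** complex_mat S) X = z * of_real (X \<bullet> (S *v X))"
proof -
  have "(mat z ** complex_mat S) *v complex_vec X = z *s complex_vec (S *v X)"
    by (simp add: vec_eq_iff matrix_vector_mult_def mat_mult_nth complex_vec_def sum_distrib_left mult_ac)
  then show ?thesis
    by (simp add: quad_form_def scalar_product_def inner_vec_def complex_vec_def sum_distrib_left mult_ac)
qed

lemma Re_quad_form: "Re (quad_form Q X) = qf (Re_matrix Q) X"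
proof -
  have "quad_form Q X = quad_form (mat 1 ** complex_mat (Re_matrix Q)) X + quad_form (mat \<i> ** complex_mat (Im_matrix Q)) X"
    by (subst complex_matrix_eq[of Q])
      (simp add: quad_form_def scalar_product_def mv.add_left sum.distrib algebra_simps)
  then show ?thesis
    unfolding quad_form_mat_mult by (simp add: qf_def)
qed

lemma bounded_linear_Re_quad_form: "bounded_linear (\<lambda>A. Re (quad_form A X))"
proof -
  have "linear (\<lambda>A. Re (quad_form A X))"
    unfolding quad_form_def scalar_product_def
    by (rule linearI)
      (simp_all add: mv.add_left mv.scaleR_left algebra_simps sum.distrib sum_distrib_left sum_subtractf)
  then show ?thesis by (rule linear_conv_bounded_linear[THEN iffD1])
qed

section \<open>The Hamiltonian flow\<close>

definition flow_re :: "complex^('n::finite + 'n)^('n + 'n) \<Rightarrow> real \<Rightarrow> real^('n + 'n)^('n + 'n)" where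
  "flow_re Q t = Re_matrix (matrix_exp (mat (- 2 * \<i> * of_real t) ** (symplectic_J ** Q)))"

definition flow_im :: "complex^('n::finite + 'n)^('n + 'n) \<Rightarrow> real \<Rightarrow> real^('n + 'n)^('n + 'n)" where
  "flow_im Q t = Im_matrix (matrix_exp (mat (- 2 * \<i> * of_real t) ** (symplectic_J ** Q)))"

lemma flow_0 [simp]: "flow_re Q 0 = mat 1" "flow_im Q 0 = 0"
proof -
  have E: "matrix_exp (mat (- 2 * \<i> * of_real 0) ** (symplectic_J ** Q)) = mat 1"
    by (simp add: mm.zero_left)
  show "flow_re Q 0 = mat 1" "flow_im Q 0 = 0"
    by (simp_all only: flow_re_def flow_im_def E) (simp_all add: vec_eq_iff mat_def)
qed

lemma bounded_linear_Re_Im_matrix: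
  "bounded_linear (Re_matrix :: complex^'n::finite^'n \<Rightarrow> _)" "bounded_linear (Im_matrix :: complex^'n::finite^'n \<Rightarrow> _)"
  by (auto intro!: linear_conv_bounded_linear[THEN iffD1] linearI simp: vec_eq_iff)

lemma has_vector_derivative_flow:
  fixes Q :: "complex^('n::finite + 'n)^('n + 'n)"
  shows "(flow_re Q has_vector_derivative 2 *\<^sub>R (symplectic_J ** Im_matrix Q ** flow_re Q t +
      symplectic_J ** Re_matrix Q ** flow_im Q t)) (at t within S)"
    and "(flow_im Q has_vector_derivative 2 *\<^sub>R (symplectic_J ** Im_matrix Q ** flow_im Q t -
      symplectic_J ** Re_matrix Q ** flow_re Q t)) (at t within S)"
proof -
  define G where "G t = matrix_exp (mat (- 2 * \<i> * of_real t) ** (symplectic_J ** Q))" for t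
  have G: "(G has_vector_derivative mat (- 2 * \<i>) ** (symplectic_J ** Q) ** G t) (at t within S)"
    unfolding G_def by (rule has_vector_derivative_matrix_exp)
  have m: "Re_matrix (mat (- (2 * \<i>)) ** A) = 2 *\<^sub>R Im_matrix A"
    "Im_matrix (mat (- (2 * \<i>)) ** A) = - (2 *\<^sub>R Re_matrix A)"
    for A :: "complex^('n + 'n)^('n + 'n)"
    by (simp_all add: vec_eq_iff mat_mult_nth)
  have fl: "flow_re Q = (\<lambda>t. Re_matrix (G t))" "flow_im Q = (\<lambda>t. Im_matrix (G t))"
    by (auto simp: flow_re_def flow_im_def G_def)
  show "(flow_re Q has_vector_derivative 2 *\<^sub>R (symplectic_J ** Im_matrix Q ** flow_re Q t +
      symplectic_J ** Re_matrix Q ** flow_im Q t)) (at t within S)"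
    using bounded_linear.has_vector_derivative[OF bounded_linear_Re_Im_matrix(1) G]
    by (simp add: fl matrix_mul_assoc[symmetric] m) (simp add: Re_Im_matrix_mult Re_Im_symplectic_J matrix_mul_assoc mm.add_right add.commute)
  show "(flow_im Q has_vector_derivative 2 *\<^sub>R (symplectic_J ** Im_matrix Q ** flow_im Q t -
      symplectic_J ** Re_matrix Q ** flow_re Q t)) (at t within S)"
    using bounded_linear.has_vector_derivative[OF bounded_linear_Re_Im_matrix(2) G]
    by (simp add: fl matrix_mul_assoc[symmetric] m)
      (simp add: Re_Im_matrix_mult Re_Im_symplectic_J matrix_mul_assoc mm.diff_right scaleR_right_diff_distrib)
qed

lemma has_vector_derivative_flow_vec:
  "((\<lambda>s. flow_re Q s *v Y) has_vector_derivative (2 *\<^sub>R (symplectic_J ** Im_matrix Q)) *v (flow_re Q t *v Y) +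
      (2 *\<^sub>R symplectic_J) *v (Re_matrix Q *v (flow_im Q t *v Y))) (at t within S)"
  "((\<lambda>s. flow_im Q s *v Y) has_vector_derivative (2 *\<^sub>R (symplectic_J ** Im_matrix Q)) *v (flow_im Q t *v Y) -
      (2 *\<^sub>R symplectic_J) *v (Re_matrix Q *v (flow_re Q t *v Y))) (at t within S)"
  using bounded_linear.has_vector_derivative[OF mv.bounded_linear_left has_vector_derivative_flow(1)[of Q t S], of Y]
    bounded_linear.has_vector_derivative[OF mv.bounded_linear_left has_vector_derivative_flow(2)[of Q t S], of Y]
  by (simp_all add: mm.scaleR_left mv.scaleR_left mv.add_left mv.diff_left matrix_vector_mul_assoc matrix_mul_assoc
      scaleR_right_distrib scaleR_right_diff_distrib)

text \<open>The pairing of real and imaginary part through \<open>J\<close>: the contributions of \<open>Im Q\<close> cancel by symmetry,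
  and those of \<open>Re Q\<close> add up.\<close>

lemma has_vector_derivative_flow_form:
  fixes Q :: "complex^('n::finite + 'n)^('n + 'n)"
  assumes Q: "transpose Q = Q"
  shows "((\<lambda>s. (flow_re Q s *v Y) \<bullet> (symplectic_J *v (flow_im Q s *v Z))) has_vector_derivative
    2 * ((flow_re Q t *v Y) \<bullet> (Re_matrix Q *v (flow_re Q t *v Z)) +
         (flow_im Q t *v Y) \<bullet> (Re_matrix Q *v (flow_im Q t *v Z)))) (at t within S)"
proof -
  have sym: "transpose (Re_matrix Q) = Re_matrix Q" "transpose (Im_matrix Q) = Im_matrix Q"
    using Q by (simp_all add: vec_eq_iff transpose_def)
  let ?x = "flow_re Q t *v Y" and ?y = "flow_im Q t *v Y" and ?x' = "flow_re Q t *v Z" and ?y' = "flow_im Q t *v Z"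
  have "((\<lambda>s. (flow_re Q s *v Y) \<bullet> (symplectic_J *v (flow_im Q s *v Z))) has_vector_derivative
      ?x \<bullet> (symplectic_J *v ((2 *\<^sub>R (symplectic_J ** Im_matrix Q)) *v ?y' - (2 *\<^sub>R symplectic_J) *v (Re_matrix Q *v ?x'))) +
      ((2 *\<^sub>R (symplectic_J ** Im_matrix Q)) *v ?x + (2 *\<^sub>R symplectic_J) *v (Re_matrix Q *v ?y)) \<bullet> (symplectic_J *v ?y'))
      (at t within S)"
    by (intro bounded_bilinear.has_vector_derivative[OF bounded_bilinear_inner] has_vector_derivative_flow_vec
        bounded_linear.has_vector_derivative[OF matrix_vector_mul_bounded_linear])
  also have "?x \<bullet> (symplectic_J *v ((2 *\<^sub>R (symplectic_J ** Im_matrix Q)) *v ?y' - (2 *\<^sub>R symplectic_J) *v (Re_matrix Q *v ?x'))) +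
      ((2 *\<^sub>R (symplectic_J ** Im_matrix Q)) *v ?x + (2 *\<^sub>R symplectic_J) *v (Re_matrix Q *v ?y)) \<bullet> (symplectic_J *v ?y')
      = 2 * (?x \<bullet> (Re_matrix Q *v ?x') + ?y \<bullet> (Re_matrix Q *v ?y'))"
    using sym_inner_commute[OF sym(1), of ?y ?y'] sym_inner_commute[OF sym(2), of ?x ?y']
    by (simp add: mv.scaleR_left mv.scaleR_right mv.diff_right matrix_vector_mul_assoc[symmetric] symplectic_J_J_vec
        inner_add_left inner_diff_right inner_symplectic_J_J del: matrix_vector_mul_assoc)
      (simp add: inner_commute)
  finally show ?thesis .
qed

text \<open>The quotient of imaginary by real part of the flow, as the tangent is that of sine by cosine; for real
  \<open>Q\<close> it is \<open>- tan (2 t J Q)\<close>.\<close>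

definition flow_tan :: "complex^('n::finite + 'n)^('n + 'n) \<Rightarrow> real \<Rightarrow> real^('n + 'n)^('n + 'n)" where
  "flow_tan Q t = flow_im Q t ** matrix_inv (flow_re Q t)"

definition flow_energy :: "complex^('n::finite + 'n)^('n + 'n) \<Rightarrow> real \<Rightarrow> real^('n + 'n)^('n + 'n)" where
  "flow_energy Q t = symplectic_J ** flow_tan Q t"

text \<open>The conjugate of \<open>exp(-2itJQ) = U + iV\<close> is inverse to the second factor of the polar product. Multiplying the
  product by \<open>1 - iV U\<^sup>-\<^sup>1 = (U - iV) U\<^sup>-\<^sup>1\<close> therefore leaves \<open>(U + iV) U\<^sup>-\<^sup>1\<close>.\<close>

lemma polar_product_cayley:
  fixes Q :: "complex^('n::finite + 'n)^('n + 'n)"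
  assumes inv: "invertible (flow_re Q t)"
  defines "W \<equiv> mat \<i> ** complex_mat (flow_tan Q t)"
  shows "polar_product Q t ** (mat 1 - W) = mat 1 + W"
proof -
  define B where "B = mat (- 2 * \<i> * of_real t) ** (symplectic_J ** Q)"
  define B' where "B' = mat (- 2 * \<i> * of_real t) ** (symplectic_J ** map_matrix cnj Q)"
  have P: "polar_product Q t = matrix_exp B ** matrix_exp B'"
    by (simp add: polar_product_def B_def B'_def matrix_mul_assoc)
  have cJ: "map_matrix cnj symplectic_J = (symplectic_J :: complex^('n + 'n)^('n + 'n))"
    using cnj_matrix_eq[of "symplectic_J :: complex^('n + 'n)^('n + 'n)"] complex_matrix_eq[of "symplectic_J :: complex^('n + 'n)^('n + 'n)"]
    by (simp add: Re_Im_symplectic_J complex_mat_symplectic_J vec_eq_iff mat_mult_nth)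
  have cm: "map_matrix cnj (A ** C) = map_matrix cnj A ** map_matrix cnj C" for A C :: "complex^('n + 'n)^('n + 'n)"
    by (simp add: vec_eq_iff matrix_matrix_mult_def)
  have "map_matrix cnj B = - B'"
    unfolding B_def B'_def cm cJ by (simp add: vec_eq_iff mat_mult_nth) (simp add: vec_eq_iff mat_def mat_mult_nth[symmetric] matrix_matrix_mult_def if_distrib if_distribR cong: if_cong)
  then have "matrix_exp B' ** map_matrix cnj (matrix_exp B) = mat 1"
    using matrix_exp_minus[of B'] by (simp add: matrix_exp_cnj[symmetric])
  moreover have "mat 1 - W = map_matrix cnj (matrix_exp B) ** complex_mat (matrix_inv (flow_re Q t))"
    "mat 1 + W = matrix_exp B ** complex_mat (matrix_inv (flow_re Q t))"
  proof -
    have re: "Re_matrix (matrix_exp B) = flow_re Q t" "Im_matrix (matrix_exp B) = flow_im Q t"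
      by (simp_all add: B_def flow_re_def flow_im_def)
    have 1: "complex_mat (flow_re Q t) ** complex_mat (matrix_inv (flow_re Q t)) = mat 1"
      by (simp add: complex_mat_mult[symmetric] matrix_inv_mult(1)[OF inv])
    show "mat 1 - W = map_matrix cnj (matrix_exp B) ** complex_mat (matrix_inv (flow_re Q t))"
      unfolding cnj_matrix_eq re mm.diff_left 1 W_def flow_tan_def complex_mat_mult by (simp add: matrix_mul_assoc)
    show "mat 1 + W = matrix_exp B ** complex_mat (matrix_inv (flow_re Q t))"
      by (subst complex_matrix_eq[of "matrix_exp B"])
        (simp add: re mm.add_left 1 W_def flow_tan_def complex_mat_mult matrix_mul_assoc)
  qed
  ultimately show ?thesis
    unfolding P by (metis (no_types, lifting) matrix_mul_assoc matrix_mul_rid)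
qed


text \<open>The vector \<open>Y X\<close> is the initial value of the trajectory whose real part is \<open>X\<close> at time \<open>t\<close>.\<close>

lemma flow_energy_form:
  assumes "invertible (flow_re Q t)"
  defines "Y \<equiv> \<lambda>X. matrix_inv (flow_re Q t) *v X"
  shows "flow_re Q t *v Y X = X"
    and "X \<bullet> (flow_energy Q t *v Z) = (flow_re Q t *v Y X) \<bullet> (symplectic_J *v (flow_im Q t *v Y Z))"
  using assms by (simp_all add: matrix_vector_mul_assoc matrix_inv_mult flow_energy_def flow_tan_def matrix_mul_assoc)

text \<open>The derivative of \<open>x \<bullet> J y'\<close> along two trajectories is symmetric in them, and both pairings vanish at
  time zero.\<close>

lemma transpose_flow_energy:
  assumes Q: "transpose Q = Q" and inv: "invertible (flow_re Q t)"
  shows "transpose (flow_energy Q t) = flow_energy Q t"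
proof (rule transpose_eqI)
  fix X Z
  define Y where "Y = matrix_inv (flow_re Q t) *v X"
  define Y' where "Y' = matrix_inv (flow_re Q t) *v Z"
  define f where "f Y Z s = (flow_re Q s *v Y) \<bullet> (symplectic_J *v (flow_im Q s *v Z))" for Y Z s
  have sym: "transpose (Re_matrix Q) = Re_matrix Q"
    using Q by (simp add: vec_eq_iff transpose_def)
  have "((\<lambda>s. f Y Y' s - f Y' Y s) has_vector_derivative 0) (at s within UNIV)" for s
  proof -
    have "((\<lambda>s. f Y Y' s - f Y' Y s) has_vector_derivative
      (2 * ((flow_re Q s *v Y) \<bullet> (Re_matrix Q *v (flow_re Q s *v Y')) +
         (flow_im Q s *v Y) \<bullet> (Re_matrix Q *v (flow_im Q s *v Y'))) -
       2 * ((flow_re Q s *v Y') \<bullet> (Re_matrix Q *v (flow_re Q s *v Y)) +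
         (flow_im Q s *v Y') \<bullet> (Re_matrix Q *v (flow_im Q s *v Y))))) (at s within UNIV)"
      unfolding f_def by (intro has_vector_derivative_diff has_vector_derivative_flow_form Q)
    then show ?thesis
      using sym_inner_commute[OF sym, of "flow_re Q s *v Y" "flow_re Q s *v Y'"]
        sym_inner_commute[OF sym, of "flow_im Q s *v Y" "flow_im Q s *v Y'"] by simp
  qed
  then obtain c where "\<And>s. f Y Y' s - f Y' Y s = c"
    using has_vector_derivative_zero_constant[of UNIV "\<lambda>s. f Y Y' s - f Y' Y s"] by (metis UNIV_I convex_UNIV)
  from this[of t] this[of 0] have "f Y Y' t = f Y' Y t"
    by (simp add: f_def)
  then show "X \<bullet> (flow_energy Q t *v Z) = Z \<bullet> (flow_energy Q t *v X)"
    by (simp add: flow_energy_form(2)[OF inv] f_def Y_def Y'_def)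
qed

text \<open>The integral runs backwards along the trajectory, starting from its end point at time \<open>t\<close>.\<close>

lemma flow_energy_integral:
  fixes X :: "real^('n::finite + 'n)"
  assumes Q: "transpose Q = Q" and inv: "invertible (flow_re Q t)" and t: "0 \<le> t"
  defines "Y \<equiv> matrix_inv (flow_re Q t) *v X"
  shows "((\<lambda>s. qf (Re_matrix Q) (flow_re Q (t - s) *v Y) + qf (Re_matrix Q) (flow_im Q (t - s) *v Y))
    has_integral qf (flow_energy Q t) X / 2) {0..t}"
proof -
  define f where "f s = (flow_re Q s *v Y) \<bullet> (symplectic_J *v (flow_im Q s *v Y))" for s
  define g where "g s = qf (Re_matrix Q) (flow_re Q s *v Y) + qf (Re_matrix Q) (flow_im Q s *v Y)" for s
  have "((\<lambda>s. f (t - s)) has_vector_derivative - (2 * g (t - s))) (at s within {0..t})" for s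
  proof -
    have "(f has_vector_derivative 2 * g (t - s)) (at (t - s))"
      unfolding f_def g_def qf_def by (rule has_vector_derivative_flow_form[OF Q])
    moreover have "((\<lambda>s. t - s) has_vector_derivative - 1) (at s)"
      by (auto intro!: derivative_eq_intros)
    ultimately have "(f \<circ> (\<lambda>s. t - s) has_vector_derivative - 1 *\<^sub>R (2 * g (t - s))) (at s)"
      by (intro vector_diff_chain_at) auto
    then show ?thesis
      by (auto simp: o_def intro: has_vector_derivative_at_within)
  qed
  then have "((\<lambda>s. - (2 * g (t - s))) has_integral (f (t - t) - f (t - 0))) {0..t}"
    using t by (intro fundamental_theorem_of_calculus) auto
  from has_integral_mult_right[OF this, of "- 1 / 2"]
  have "((\<lambda>s. g (t - s)) has_integral f t / 2) {0..t}"
    by (simp add: f_def)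
  then show ?thesis
    by (simp add: g_def f_def qf_def flow_energy_form(2)[OF inv] Y_def)
qed

text \<open>The reversed trajectory obeys \<open>x' = -2 Im F x - 2 J R y\<close>, which is a flow perturbed through \<open>R\<close>. The factors
  \<open>4\<^sup>j\<close> that arise from \<open>-2 Im F\<close> only help.\<close>

lemma flow_energy_lower_bound:
  fixes Q :: "complex^('n::finite + 'n)^('n + 'n)"
  assumes Q: "transpose Q = Q" and R: "psd (Re_matrix Q)"
    and ker: "\<And>x m. (\<And>j. j \<le> k \<Longrightarrow> qf (Re_matrix Q) (matrix_pow (symplectic_J ** Im_matrix Q) j *v x) = 0) \<Longrightarrow>
      qf (Re_matrix Q) (matrix_pow (symplectic_J ** Im_matrix Q) m *v x) = 0"
  shows "\<exists>T c. 0 < T \<and> T < 1 \<and> 0 < c \<and> (\<forall>t X. 0 < t \<and> t \<le> T \<and> invertible (flow_re Q t) \<longrightarrow>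
      c * (\<Sum>j<Suc k. t ^ (2 * j + 1) * qf (Re_matrix Q) (matrix_pow (symplectic_J ** Im_matrix Q) j *v X)) \<le>
        qf (flow_energy Q t) X)"
proof -
  let ?R = "Re_matrix Q"
  define F where "F = symplectic_J ** Im_matrix Q"
  define A where "A = (- 2) *\<^sub>R F"
  define E where "E = (- 2) *\<^sub>R (symplectic_J :: real^('n + 'n)^('n + 'n))"
  have pow: "qf ?R (matrix_pow A j *v x) = 4 ^ j * qf ?R (matrix_pow F j *v x)" for j x
    unfolding A_def matrix_pow_scaleR_mult qf_scaleR by (simp add: power2_eq_square flip: power_mult_distrib)
  have kerA: "qf ?R (matrix_pow A m *v x) = 0" if "\<And>j. j \<le> k \<Longrightarrow> qf ?R (matrix_pow A j *v x) = 0" for m x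
    using ker[of x m] that unfolding pow F_def by simp
  have "\<exists>T c. 0 < T \<and> T < 1 \<and> 0 < c \<and> (\<forall>t x y. 0 < t \<and> t \<le> T \<and>
      (\<forall>s\<in>{0..t}. (x has_vector_derivative A *v x s + E *v (?R *v y s)) (at s within {0..t})) \<and>
      continuous_on {0..t} y \<longrightarrow>
      c * (\<Sum>j<Suc k. t ^ (2 * j + 1) * qf ?R (matrix_pow A j *v x 0)) \<le>
        integral {0..t} (\<lambda>s. qf ?R (x s) + qf ?R (y s)))"
    by (rule perturbed_flow_lower_bound[OF R]) (rule kerA)
  then obtain T c where *: "0 < T \<and> T < 1 \<and> 0 < c \<and> (\<forall>t x y. 0 < t \<and> t \<le> T \<and>
      (\<forall>s\<in>{0..t}. (x has_vector_derivative A *v x s + E *v (?R *v y s)) (at s within {0..t})) \<and>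
      continuous_on {0..t} y \<longrightarrow>
      c * (\<Sum>j<Suc k. t ^ (2 * j + 1) * qf ?R (matrix_pow A j *v x 0)) \<le>
        integral {0..t} (\<lambda>s. qf ?R (x s) + qf ?R (y s)))"
    by (elim exE) (rule that, assumption)
  then have Tc: "0 < T" "T < 1" "0 < c" by simp_all
  have bound: "c * (\<Sum>j<Suc k. t ^ (2 * j + 1) * qf ?R (matrix_pow A j *v x 0)) \<le>
        integral {0..t} (\<lambda>s. qf ?R (x s) + qf ?R (y s))"
    if "0 < t" "t \<le> T"
      "\<And>s. s \<in> {0..t} \<Longrightarrow> (x has_vector_derivative A *v x s + E *v (?R *v y s)) (at s within {0..t})"
      "continuous_on {0..t} y" for t x y
    by (intro *[THEN conjunct2, THEN conjunct2, THEN conjunct2, THEN spec, THEN spec, THEN spec, THEN mp]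
        conjI ballI that)
  have "2 * c * (\<Sum>j<Suc k. t ^ (2 * j + 1) * qf ?R (matrix_pow F j *v X)) \<le> qf (flow_energy Q t) X"
    if t: "0 < t" "t \<le> T" and inv: "invertible (flow_re Q t)" for t X
  proof -
    define Y where "Y = matrix_inv (flow_re Q t) *v X"
    define x where "x s = flow_re Q (t - s) *v Y" for s
    define y where "y s = flow_im Q (t - s) *v Y" for s
    have rev: "((\<lambda>s. t - s) has_vector_derivative - 1) (at s)" for s
      by (auto intro!: derivative_eq_intros)
    have x: "(x has_vector_derivative A *v x s + E *v (?R *v y s)) (at s within {0..t})" for s
    proof -
      have "((\<lambda>s. flow_re Q s *v Y) \<circ> (\<lambda>s. t - s) has_vector_derivative - 1 *\<^sub>R
          ((2 *\<^sub>R (symplectic_J ** Im_matrix Q)) *v (flow_re Q (t - s) *v Y) +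
          (2 *\<^sub>R symplectic_J) *v (Re_matrix Q *v (flow_im Q (t - s) *v Y)))) (at s)"
        by (intro vector_diff_chain_at rev has_vector_derivative_flow_vec(1))
      moreover have "- 1 *\<^sub>R ((2 *\<^sub>R (symplectic_J ** Im_matrix Q)) *v (flow_re Q (t - s) *v Y) +
          (2 *\<^sub>R symplectic_J) *v (Re_matrix Q *v (flow_im Q (t - s) *v Y))) = A *v x s + E *v (?R *v y s)"
        unfolding A_def E_def F_def x_def y_def by (simp add: mv.scaleR_left mv.minus_left)
      moreover have "(\<lambda>s. flow_re Q s *v Y) \<circ> (\<lambda>s. t - s) = x"
        by (auto simp: x_def)
      ultimately show ?thesis
        by (simp only:) (rule has_vector_derivative_at_within)
    qed
    have y: "continuous_on {0..t} y"
    proof -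
      have "((\<lambda>s. flow_im Q s *v Y) \<circ> (\<lambda>s. t - s) has_vector_derivative - 1 *\<^sub>R
          ((2 *\<^sub>R (symplectic_J ** Im_matrix Q)) *v (flow_im Q (t - s) *v Y) -
          (2 *\<^sub>R symplectic_J) *v (Re_matrix Q *v (flow_re Q (t - s) *v Y)))) (at s)" for s
        by (intro vector_diff_chain_at rev has_vector_derivative_flow_vec(2))
      then show ?thesis
        unfolding y_def o_def by (meson continuous_at_imp_continuous_on has_vector_derivative_continuous)
    qed
    have x0: "x 0 = X"
      using flow_energy_form(1)[OF inv] by (simp add: x_def Y_def)
    have "c * (\<Sum>j<Suc k. t ^ (2 * j + 1) * qf ?R (matrix_pow F j *v X))
        \<le> c * (\<Sum>j<Suc k. t ^ (2 * j + 1) * qf ?R (matrix_pow A j *v x 0))"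
    proof (intro mult_left_mono sum_mono)
      show "qf ?R (matrix_pow F j *v X) \<le> qf ?R (matrix_pow A j *v x 0)" for j
        using mult_right_mono[of 1 "4 ^ j" "qf ?R (matrix_pow F j *v X)"] psd_nonneg[OF R] by (simp add: pow x0)
    qed (use t Tc in auto)
    also have "\<dots> \<le> integral {0..t} (\<lambda>s. qf ?R (x s) + qf ?R (y s))"
      by (rule bound[OF t x y])
    also have "\<dots> = qf (flow_energy Q t) X / 2"
      using integral_unique[OF flow_energy_integral[OF Q inv less_imp_le[OF t(1)]]]
      by (simp only: x_def y_def Y_def)
    finally show ?thesis by simp
  qed
  then show ?thesis
    unfolding F_def using Tc by - (rule exI[of _ T], rule exI[of _ "2 * c"], auto)
qed

lemma has_vector_derivative_quotient_tendsto:
  assumes "(f has_vector_derivative D) (at 0)" "f 0 = 0"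
  shows "((\<lambda>t. (1 / t) *\<^sub>R f t) \<longlongrightarrow> D) (at 0)"
proof -
  have "((\<lambda>t. norm (f t - t *\<^sub>R D) / norm t) \<longlongrightarrow> 0) (at 0)"
    using assms unfolding has_vector_derivative_def
    by (simp add: has_derivative_iff_norm)
  then have "((\<lambda>t. (1 / t) *\<^sub>R f t - D) \<longlongrightarrow> 0) (at 0)"
  proof (rule Lim_null_comparison[rotated])
    show "\<forall>\<^sub>F t in at 0. norm ((1 / t) *\<^sub>R f t - D) \<le> norm (f t - t *\<^sub>R D) / norm t"
      unfolding eventually_at_filter
    proof (intro always_eventually allI impI)
      fix t :: real assume "t \<noteq> 0"
      then have "(1 / t) *\<^sub>R f t - D = (1 / t) *\<^sub>R (f t - t *\<^sub>R D)"
        by (simp add: scaleR_diff_right)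
      then show "norm ((1 / t) *\<^sub>R f t - D) \<le> norm (f t - t *\<^sub>R D) / norm t"
        by (simp add: divide_inverse mult.commute)
    qed
  qed
  then show ?thesis by (rule LIM_zero_cancel)
qed

lemma flow_near_0:
  fixes Q :: "complex^('n::finite + 'n)^('n + 'n)"
  shows "\<forall>\<^sub>F t in at 0. invertible (flow_re Q t) \<and> norm (flow_tan Q t) \<le> 1/10"
    and "\<exists>D. ((\<lambda>t. (1 / t) *\<^sub>R flow_tan Q t) \<longlongrightarrow> D) (at 0)"
    and "(flow_tan Q \<longlongrightarrow> 0) (at 0)"
proof -
  have "isCont (flow_re Q) 0"
    using has_vector_derivative_continuous[OF has_vector_derivative_flow(1)[of Q 0 UNIV]] by simp
  then have U: "(flow_re Q \<longlongrightarrow> mat 1) (at 0)"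
    by (simp add: isCont_def)
  then have "((\<lambda>t. norm (mat 1 - flow_re Q t)) \<longlongrightarrow> norm (mat 1 - mat 1 :: real^('n + 'n)^('n + 'n))) (at 0)"
    by (intro tendsto_intros)
  then have U0: "((\<lambda>t. norm (mat 1 - flow_re Q t)) \<longlongrightarrow> 0) (at 0)"
    by simp
  then have half: "\<forall>\<^sub>F t in at 0. norm (mat 1 - flow_re Q t) < 1/2"
    by (rule order_tendstoD) simp
  then have inv: "\<forall>\<^sub>F t in at 0. invertible (flow_re Q t)"
    by eventually_elim (rule invertible_near_1, simp)
  have "((\<lambda>t. matrix_inv (flow_re Q t) - mat 1) \<longlongrightarrow> 0) (at 0)"
  proof (rule Lim_null_comparison)
    show "\<forall>\<^sub>F t in at 0. norm (matrix_inv (flow_re Q t) - mat 1) \<le>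
        2 * norm (mat 1 :: real^('n + 'n)^('n + 'n)) * norm (mat 1 - flow_re Q t)"
      using half by eventually_elim (rule norm_matrix_inv_minus_1, simp)
    show "((\<lambda>t. 2 * norm (mat 1 :: real^('n + 'n)^('n + 'n)) * norm (mat 1 - flow_re Q t)) \<longlongrightarrow> 0) (at 0)"
      by (intro tendsto_mult_right_zero U0)
  qed
  then have Uinv: "((\<lambda>t. matrix_inv (flow_re Q t)) \<longlongrightarrow> mat 1) (at 0)"
    by (rule LIM_zero_cancel)
  have "((\<lambda>t. (1 / t) *\<^sub>R flow_im Q t) \<longlongrightarrow> 2 *\<^sub>R (symplectic_J ** Im_matrix Q ** flow_im Q 0 -
      symplectic_J ** Re_matrix Q ** flow_re Q 0)) (at 0)"
    by (rule has_vector_derivative_quotient_tendsto[OF has_vector_derivative_flow(2)]) simp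
  from mm.tendsto[OF this Uinv]
  obtain D where D: "((\<lambda>t. (1 / t) *\<^sub>R flow_tan Q t) \<longlongrightarrow> D) (at 0)"
    by (auto simp: flow_tan_def mm.scaleR_left)
  have "((\<lambda>t. t *\<^sub>R ((1 / t) *\<^sub>R flow_tan Q t)) \<longlongrightarrow> 0 *\<^sub>R D) (at 0)"
    by (intro tendsto_intros D)
  then have "((\<lambda>t. t *\<^sub>R ((1 / t) *\<^sub>R flow_tan Q t)) \<longlongrightarrow> 0) (at 0)"
    by (simp only: scaleR_zero_left)
  then show T: "(flow_tan Q \<longlongrightarrow> 0) (at 0)"
    by (rule Lim_transform_eventually) (auto simp: eventually_at_filter)
  have "((\<lambda>t. norm (flow_tan Q t)) \<longlongrightarrow> 0) (at 0)"
    using tendsto_norm[OF T] by simp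
  then have "\<forall>\<^sub>F t in at 0. norm (flow_tan Q t) < 1/10"
    by (rule order_tendstoD) simp
  with inv show "\<forall>\<^sub>F t in at 0. invertible (flow_re Q t) \<and> norm (flow_tan Q t) \<le> 1/10"
    by eventually_elim simp
  show "\<exists>D. ((\<lambda>t. (1 / t) *\<^sub>R flow_tan Q t) \<longlongrightarrow> D) (at 0)"
    using D by blast
qed

section \<open>The polar form\<close>

text \<open>Symmetry of \<open>J D\<close> means that \<open>D\<close> is skew for the symplectic form, so each factor of \<open>D\<close> changes
  sides at the cost of a sign.\<close>

lemma inner_symplectic_J_pow:
  fixes D :: "real^('n::finite + 'n)^('n + 'n)"
  assumes C: "transpose (symplectic_J ** D) = symplectic_J ** D"
  shows "X \<bullet> (symplectic_J *v (matrix_pow D m *v Z)) = (- 1) ^ m * ((matrix_pow D m *v X) \<bullet> (symplectic_J *v Z))"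
proof (induction m arbitrary: Z)
  case (Suc m)
  let ?W = "matrix_pow D m *v Z"
  have 1: "V \<bullet> (symplectic_J *v (D *v W)) = - ((D *v V) \<bullet> (symplectic_J *v W))" for V W
    using sym_inner_commute[OF C, of V W] inner_symplectic_J[of W "D *v V"]
    by (simp add: matrix_vector_mul_assoc[symmetric] inner_commute)
  have "X \<bullet> (symplectic_J *v (matrix_pow D (Suc m) *v Z)) = X \<bullet> (symplectic_J *v (matrix_pow D m *v (D *v Z)))"
    by (simp add: matrix_vector_mul_assoc matrix_pow_commute)
  also have "\<dots> = (- 1) ^ m * ((matrix_pow D m *v X) \<bullet> (symplectic_J *v (D *v Z)))"
    by (rule Suc)
  also have "\<dots> = (- 1) ^ Suc m * ((matrix_pow D (Suc m) *v X) \<bullet> (symplectic_J *v Z))"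
    unfolding 1 by (simp add: matrix_vector_mul_assoc)
  finally show ?case .
qed simp

lemma polar_matrix_nz_eq:
  fixes Q :: "complex^('n::finite + 'n)^('n + 'n)"
  assumes "t \<noteq> 0"
  shows "polar_matrix_nz Q t = mat (1 / (4 * \<i> * of_real t)) ** symplectic_J ** matrix_Ln (polar_product Q t)"
proof -
  let ?z = "4 * \<i> * complex_of_real t"
  let ?J = "symplectic_J :: complex^('n + 'n)^('n + 'n)"
  have "(mat ?z ** ?J) ** (mat (1 / ?z) ** ?J) = mat ?z ** (?J ** mat (1 / ?z)) ** ?J"
    by (simp only: matrix_mul_assoc)
  also have "\<dots> = mat ?z ** mat (1 / ?z) ** (?J ** ?J)"
    by (simp only: mat_commute[of "1 / ?z" ?J, symmetric] matrix_mul_assoc)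
  also have "\<dots> = - mat 1"
    using assms by (simp add: mat_mult_mat symplectic_J_square)
  finally have "(mat ?z ** ?J) ** (- (mat (1 / ?z) ** ?J)) = mat 1"
    by (simp add: mm.minus_right)
  then have "matrix_inv (mat ?z ** symplectic_J) = (- (mat (1 / ?z) ** symplectic_J) :: complex^('n + 'n)^('n + 'n))"
    by (rule matrix_inv_eqI)
  then show ?thesis
    by (simp only: polar_matrix_nz_def mm.minus_left minus_minus)
qed

text \<open>In the term of degree \<open>2m + 1\<close> of the series of \<open>Log P\<close>, the sign \<open>(-1)\<^sup>m\<close> from the power of \<open>i\<close> cancels
  the one from moving \<open>m\<close> factors of \<open>D\<close> across the symplectic form. All terms are thus
  nonnegative, and the one with \<open>m = 0\<close> is the bound.\<close>

lemma polar_form_ge_flow_energy: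
  fixes Q :: "complex^('n::finite + 'n)^('n + 'n)"
  assumes Q: "transpose Q = Q" and t: "0 < t" and inv: "invertible (flow_re Q t)"
    and small: "norm (flow_tan Q t) \<le> 1/10"
    and pos: "\<And>X. 0 \<le> qf (flow_energy Q t) X"
  shows "qf (flow_energy Q t) X / (2 * t) \<le> polar_form Q t X"
proof -
  define D where "D = flow_tan Q t"
  define W where "W = mat \<i> ** complex_mat D"
  define c where "c n = (if odd n then 2 / real n else 0)" for n
  define f where "f n = Re (quad_form (mat (1 / (4 * \<i> * of_real t)) ** symplectic_J ** (c n *\<^sub>R matrix_pow W n)) X)" for n
  have C: "transpose (symplectic_J ** D) = symplectic_J ** D"
    using transpose_flow_energy[OF Q inv] by (simp add: flow_energy_def D_def)
  have "(\<lambda>n. c n *\<^sub>R matrix_pow W n) sums matrix_Ln (polar_product Q t)"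
    unfolding c_def W_def D_def
    by (rule matrix_Ln_sums) (simp_all only: norm_mat_i_complex_mat small polar_product_cayley[OF inv])
  then have "f sums polar_form Q t X"
    unfolding f_def polar_form_def polar_matrix_def using t
    by (simp add: polar_matrix_nz_eq)
      (intro bounded_linear.sums[OF bounded_linear_Re_quad_form] bounded_linear.sums[OF mm.bounded_linear_right])
  moreover have f: "f (2 * m + 1) = qf (flow_energy Q t) (matrix_pow D m *v X) / (2 * t * real (2 * m + 1))" for m
  proof -
    let ?n = "2 * m + 1"
    have "mat (1 / (4 * \<i> * of_real t)) ** symplectic_J ** (c ?n *\<^sub>R matrix_pow W ?n) =
        mat (of_real (c ?n) * \<i> ^ ?n / (4 * \<i> * of_real t)) ** complex_mat (symplectic_J ** matrix_pow D ?n)"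
    proof -
      have "c ?n *\<^sub>R matrix_pow W ?n = mat (of_real (c ?n)) ** mat (\<i> ^ ?n) ** complex_mat (matrix_pow D ?n)"
        by (simp only: W_def matrix_pow_mat_mult complex_mat_pow vec_eq_iff vector_scaleR_component
            matrix_mul_assoc[symmetric] mat_mult_nth) (simp add: scaleR_conv_of_real)
      then have "mat (1 / (4 * \<i> * of_real t)) ** symplectic_J ** (c ?n *\<^sub>R matrix_pow W ?n) =
          mat (1 / (4 * \<i> * of_real t)) ** (symplectic_J ** (mat (of_real (c ?n) * \<i> ^ ?n) ** complex_mat (matrix_pow D ?n)))"
        by (simp only: mat_mult_mat matrix_mul_assoc)
      also have "symplectic_J ** (mat (of_real (c ?n) * \<i> ^ ?n) ** complex_mat (matrix_pow D ?n)) =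
          mat (of_real (c ?n) * \<i> ^ ?n) ** (symplectic_J ** complex_mat (matrix_pow D ?n))"
        by (simp only: mat_commute[of _ symplectic_J] matrix_mul_assoc)
      finally show ?thesis
        by (simp only: complex_mat_mult complex_mat_symplectic_J matrix_mul_assoc mat_mult_mat) simp
    qed
    then have "f ?n = Re (of_real (c ?n) * \<i> ^ ?n / (4 * \<i> * of_real t)) * (X \<bullet> (symplectic_J *v (matrix_pow D ?n *v X)))"
      unfolding f_def by (simp only: quad_form_mat_mult) (simp add: matrix_vector_mul_assoc)
    also have "of_real (c ?n) * \<i> ^ ?n / (4 * \<i> * of_real t) = of_real (c ?n * (- 1) ^ m / (4 * t))"
      by (simp add: power_mult)
    also have "matrix_pow D ?n *v X = matrix_pow D m *v (D *v (matrix_pow D m *v X))"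
      by (simp add: matrix_vector_mul_assoc mult_2 matrix_pow_add matrix_mul_assoc matrix_pow_commute)
    also have "X \<bullet> (symplectic_J *v (matrix_pow D m *v (D *v (matrix_pow D m *v X)))) =
        (- 1) ^ m * qf (flow_energy Q t) (matrix_pow D m *v X)"
      unfolding inner_symplectic_J_pow[OF C] by (simp add: qf_def flow_energy_def D_def matrix_vector_mul_assoc matrix_mul_assoc)
    finally have "f ?n = c ?n * ((- 1) ^ m * (- 1) ^ m) * qf (flow_energy Q t) (matrix_pow D m *v X) / (4 * t)"
      by simp
    moreover have "(- 1) ^ m * (- 1) ^ m = (1 :: real)"
      by (simp flip: power_mult_distrib)
    moreover have "c ?n = 2 / real ?n"
      by (simp add: c_def)
    moreover have "2 / N * 1 * x / (4 * t) = x / (2 * t * N)" if "N > 0" for N x :: real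
      using t that by (simp add: field_simps)
    ultimately show ?thesis by simp
  qed
  moreover have "f n \<ge> 0" for n
  proof (cases "even n")
    case True
    then show ?thesis by (simp add: f_def c_def mm.zero_right quad_form_def scalar_product_def)
  next
    case False
    then obtain m where "n = 2 * m + 1" by (auto elim: oddE)
    then show ?thesis unfolding \<open>n = 2 * m + 1\<close> f using pos t by simp
  qed
  ultimately have "sum f {1} \<le> polar_form Q t X"
    using sum_le_suminf[of f "{1}"] by (simp add: sums_iff)
  then show ?thesis using f[of 0] by simp
qed


text \<open>The logarithm is \<open>2W\<close> up to an error quadratic in \<open>W\<close>, and \<open>W / t\<close> converges since \<open>W\<close> is
  differentiable at zero and vanishes there.\<close>

lemma polar_matrix_tendsto:
  fixes Q :: "complex^('n::finite + 'n)^('n + 'n)"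
  shows "(polar_matrix_nz Q \<longlongrightarrow> polar_matrix Q 0) (at 0)"
proof -
  define W where "W t = mat \<i> ** complex_mat (flow_tan Q t)" for t
  define L where "L t = matrix_Ln (polar_product Q t)" for t
  have norm_W: "norm (W t) = norm (flow_tan Q t)" for t
    unfolding W_def by (rule norm_mat_i_complex_mat)
  have W_scale: "(1 / t) *\<^sub>R W t = mat \<i> ** complex_mat ((1 / t) *\<^sub>R flow_tan Q t)" for t
    by (simp only: W_def vec_eq_iff vector_scaleR_component mat_mult_nth complex_mat_nth)
      (simp add: scaleR_conv_of_real)
  obtain D where D: "((\<lambda>t. (1 / t) *\<^sub>R flow_tan Q t) \<longlongrightarrow> D) (at 0)"
    using flow_near_0(2) by blast
  have "((\<lambda>t. complex_mat ((1 / t) *\<^sub>R flow_tan Q t)) \<longlongrightarrow> complex_mat D) (at 0)"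
  proof (intro vec_tendstoI)
    fix i j
    show "((\<lambda>t. complex_mat ((1 / t) *\<^sub>R flow_tan Q t) $ i $ j) \<longlongrightarrow> complex_mat D $ i $ j) (at 0)"
      unfolding complex_mat_nth by (intro tendsto_of_real tendsto_vec_nth D)
  qed
  from mm.tendsto[OF tendsto_const[of "mat \<i>"] this]
  have W': "((\<lambda>t. (1 / t) *\<^sub>R W t) \<longlongrightarrow> mat \<i> ** complex_mat D) (at 0)"
    unfolding W_scale .
  have rest: "((\<lambda>t. (1 / t) *\<^sub>R (L t - 2 *\<^sub>R W t)) \<longlongrightarrow> 0) (at 0)"
  proof (rule Lim_null_comparison)
    let ?c = "4 * norm (mat 1 :: complex^('n + 'n)^('n + 'n))"
    show "\<forall>\<^sub>F t in at 0. norm ((1 / t) *\<^sub>R (L t - 2 *\<^sub>R W t)) \<le>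
        ?c * (norm ((1 / t) *\<^sub>R flow_tan Q t) * norm (flow_tan Q t))"
      using flow_near_0(1)[of Q]
    proof eventually_elim
      case (elim t)
      have "norm (L t - 2 *\<^sub>R W t) \<le> ?c * (norm (W t))\<^sup>2"
        unfolding L_def
        by (rule matrix_Ln_approx) (use elim polar_product_cayley[of Q t] in \<open>simp_all only: W_def norm_mat_i_complex_mat\<close>)
      then have "\<bar>1 / t\<bar> * norm (L t - 2 *\<^sub>R W t) \<le> \<bar>1 / t\<bar> * (?c * (norm (W t))\<^sup>2)"
        by (intro mult_left_mono) auto
      then show ?case
        by (simp add: norm_W power2_eq_square mult_ac)
    qed
    have "((\<lambda>t. ?c * (norm ((1 / t) *\<^sub>R flow_tan Q t) * norm (flow_tan Q t))) \<longlongrightarrow>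
        ?c * (norm D * norm (0 :: real^('n + 'n)^('n + 'n)))) (at 0)"
      by (intro tendsto_intros D flow_near_0(3))
    then show "((\<lambda>t. ?c * (norm ((1 / t) *\<^sub>R flow_tan Q t) * norm (flow_tan Q t))) \<longlongrightarrow> 0) (at 0)"
      by simp
  qed
  have "((\<lambda>t. 2 *\<^sub>R ((1 / t) *\<^sub>R W t) + (1 / t) *\<^sub>R (L t - 2 *\<^sub>R W t)) \<longlongrightarrow> 2 *\<^sub>R (mat \<i> ** complex_mat D) + 0) (at 0)"
    by (intro tendsto_add rest tendsto_scaleR tendsto_const W')
  then have "((\<lambda>t. (1 / t) *\<^sub>R L t) \<longlongrightarrow> 2 *\<^sub>R (mat \<i> ** complex_mat D)) (at 0)"
    by (simp add: scaleR_diff_right)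
  from mm.tendsto[OF tendsto_const[of "mat (1 / (4 * \<i>)) ** symplectic_J"] this]
  have "((\<lambda>t. mat (1 / (4 * \<i>)) ** symplectic_J ** ((1 / t) *\<^sub>R L t)) \<longlongrightarrow>
      mat (1 / (4 * \<i>)) ** symplectic_J ** (2 *\<^sub>R (mat \<i> ** complex_mat D))) (at 0)" .
  moreover have "\<forall>\<^sub>F t in at 0. mat (1 / (4 * \<i>)) ** symplectic_J ** ((1 / t) *\<^sub>R L t) = polar_matrix_nz Q t"
    unfolding eventually_at_filter
  proof (intro always_eventually allI impI)
    fix t :: real assume t: "t \<noteq> 0"
    have "(mat (1 / (4 * \<i>)) ** (symplectic_J ** ((1 / t) *\<^sub>R L t))) $ i $ j
        = (mat (1 / (4 * \<i> * of_real t)) ** (symplectic_J ** L t)) $ i $ j" for i j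
      by (simp only: mat_mult_nth mm.scaleR_right vector_scaleR_component scaleR_conv_of_real[where 'a = complex]
          of_real_divide of_real_1 mult.assoc[symmetric] times_divide_times_eq mult_1_left)
        (simp only: mult_ac)
    then show "mat (1 / (4 * \<i>)) ** symplectic_J ** ((1 / t) *\<^sub>R L t) = polar_matrix_nz Q t"
      by (simp add: polar_matrix_nz_eq[OF t] L_def vec_eq_iff matrix_mul_assoc)
  qed
  ultimately have lim: "(polar_matrix_nz Q \<longlongrightarrow>
      mat (1 / (4 * \<i>)) ** symplectic_J ** (2 *\<^sub>R (mat \<i> ** complex_mat D))) (at 0)"
    by (rule Lim_transform_eventually)
  then have "Lim (at 0) (polar_matrix_nz Q) = mat (1 / (4 * \<i>)) ** symplectic_J ** (2 *\<^sub>R (mat \<i> ** complex_mat D))"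
    by (intro tendsto_Lim) auto
  then show ?thesis using lim by (simp add: polar_matrix_def)
qed

theorem theorem2p2:
  fixes q :: "real^('n::finite + 'n) \<Rightarrow> complex"
    and Q F :: "complex^('n + 'n)^('n + 'n)"
    and k0 :: nat
  assumes "symmetric_matrix_of Q q"
    and "\<And>X. Re (q X) \<ge> 0"
    and "F = hamilton_map Q"
    and "k0 \<le> 2 * CARD('n) - 1"
    and "singular_space F = (\<Inter>j\<in>{0..k0}. hamilton_kernel F j)"
    and "\<And>k. singular_space F = (\<Inter>j\<in>{0..k}. hamilton_kernel F j) \<Longrightarrow> k0 \<le> k"
  shows "\<exists>T c. 0 < T \<and> T < 1 \<and> c > 0 \<and>
           (\<forall>t X. 0 \<le> t \<and> t \<le> T \<longrightarrow>
              polar_form Q t X \<ge>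
                c * (\<Sum>j=0..k0. t ^ (2 * j) * Re (q (matrix_pow (Im_matrix F) j *v X))))"
proof -
  define R where "R = Re_matrix Q"
  define B where "B = symplectic_J ** Im_matrix Q"
  have Q: "transpose Q = Q" and q: "Re (q X) = qf R X" for X
    using assms(1) by (simp_all add: symmetric_matrix_of_def Re_quad_form R_def)
  have F: "Re_matrix F = symplectic_J ** R" "Im_matrix F = B"
    by (simp_all add: assms(3) Re_Im_hamilton_map R_def B_def)
  have R: "psd R"
    using Q assms(2) unfolding psd_def q by (simp add: R_def vec_eq_iff transpose_def)
  \<comment> \<open>Since \<open>J\<close> is injective and \<open>R\<close> semidefinite, the kernel of \<open>J R B\<^sup>j\<close> is the zero set of the form \<open>R\<close> at \<open>B\<^sup>j X\<close>.\<close>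
  have kernel: "X \<in> hamilton_kernel F j \<longleftrightarrow> qf R (matrix_pow B j *v X) = 0" for X j
  proof -
    have "symplectic_J *v v = 0 \<longleftrightarrow> v = 0" for v :: "real^('n + 'n)"
      using symplectic_J_J_vec[of v] by auto
    then show ?thesis
      by (simp add: hamilton_kernel_def F qf_eq_0_iff[OF R] matrix_vector_mul_assoc[symmetric])
  qed
  have "qf R (matrix_pow B m *v X) = 0" if "\<And>j. j \<le> k0 \<Longrightarrow> qf R (matrix_pow B j *v X) = 0" for X m
  proof -
    have "X \<in> singular_space F"
      unfolding assms(5) using that by (simp add: kernel)
    then show ?thesis
      by (simp add: singular_space_def kernel)
  qed
  then have ex: "\<exists>T c. 0 < T \<and> T < 1 \<and> 0 < c \<and> (\<forall>t X. 0 < t \<and> t \<le> T \<and> invertible (flow_re Q t) \<longrightarrow>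
      c * (\<Sum>j<Suc k0. t ^ (2 * j + 1) * qf R (matrix_pow B j *v X)) \<le> qf (flow_energy Q t) X)"
    unfolding R_def B_def by (intro flow_energy_lower_bound[OF Q R[unfolded R_def]]) blast
  then obtain T c where *: "0 < T \<and> T < 1 \<and> 0 < c \<and> (\<forall>t X. 0 < t \<and> t \<le> T \<and> invertible (flow_re Q t) \<longrightarrow>
      c * (\<Sum>j<Suc k0. t ^ (2 * j + 1) * qf R (matrix_pow B j *v X)) \<le> qf (flow_energy Q t) X)"
    by (elim exE) (rule that, assumption)
  then have Tc: "0 < T" "T < 1" "0 < c" by simp_all
  have energy: "c * (\<Sum>j<Suc k0. t ^ (2 * j + 1) * qf R (matrix_pow B j *v X)) \<le> qf (flow_energy Q t) X"
    if "0 < t" "t \<le> T" "invertible (flow_re Q t)" for t X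
    using * that by blast
  obtain \<delta> where \<delta>: "\<delta> > 0" "\<And>t. t \<noteq> 0 \<Longrightarrow> \<bar>t\<bar> < \<delta> \<Longrightarrow> invertible (flow_re Q t) \<and> norm (flow_tan Q t) \<le> 1/10"
    using flow_near_0(1)[of Q] unfolding eventually_at by (auto simp: dist_real_def)
  define T' where "T' = min T (\<delta> / 2)"
  define \<Sigma> where "\<Sigma> t X = c / 2 * (\<Sum>j<Suc k0. t ^ (2 * j) * qf R (matrix_pow B j *v X))" for t X
  have T': "0 < T'" "T' < 1" using Tc \<delta> by (auto simp: T'_def)
  have pos: "\<Sigma> t X \<le> polar_form Q t X" if t: "0 < t" "t \<le> T'" for t X
  proof -
    have near: "invertible (flow_re Q t)" "norm (flow_tan Q t) \<le> 1/10"
      using \<delta>(2)[of t] t \<delta>(1) by (auto simp: T'_def)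
    have "\<Sigma> t X * (2 * t) = c * (\<Sum>j<Suc k0. t ^ (2 * j + 1) * qf R (matrix_pow B j *v X))"
      by (simp add: \<Sigma>_def sum_distrib_left sum_distrib_right mult_ac del: sum.lessThan_Suc)
    also have "\<dots> \<le> qf (flow_energy Q t) X"
      by (rule energy) (use t near in \<open>auto simp: T'_def\<close>)
    finally have "\<Sigma> t X \<le> qf (flow_energy Q t) X / (2 * t)"
      using t by (simp add: pos_le_divide_eq)
    also have "\<dots> \<le> polar_form Q t X"
    proof (rule polar_form_ge_flow_energy[OF Q t(1) near])
      fix X
      have "0 \<le> qf (flow_energy Q t) X / 2"
        using has_integral_nonneg[OF flow_energy_integral[OF Q near(1)], of X] t psd_nonneg[OF R]
        by (simp add: R_def)
      then show "0 \<le> qf (flow_energy Q t) X" by simp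
    qed
    finally show ?thesis .
  qed
  have zero: "\<Sigma> 0 X \<le> polar_form Q 0 X" for X
  proof (rule tendsto_le)
    show "((\<lambda>t. Re (quad_form (polar_matrix_nz Q t) X)) \<longlongrightarrow> polar_form Q 0 X) (at_right 0)"
      unfolding polar_form_def
      by (rule bounded_linear.tendsto[OF bounded_linear_Re_quad_form
          tendsto_mono[OF at_le polar_matrix_tendsto]]) simp
    show "((\<lambda>t. \<Sigma> t X) \<longlongrightarrow> \<Sigma> 0 X) (at_right 0)"
      unfolding \<Sigma>_def by (intro tendsto_intros)
    show "\<forall>\<^sub>F t in at_right 0. \<Sigma> t X \<le> Re (quad_form (polar_matrix_nz Q t) X)"
    proof (rule eventually_at_rightI)
      show "\<Sigma> t X \<le> Re (quad_form (polar_matrix_nz Q t) X)" if "t \<in> {0<..<T'}" for t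
        using pos[of t X] that by (simp add: polar_form_def polar_matrix_def)
    qed (rule T')
  qed simp
  have "c / 2 * (\<Sum>j=0..k0. t ^ (2 * j) * Re (q (matrix_pow (Im_matrix F) j *v X))) = \<Sigma> t X" for t X
    by (simp only: \<Sigma>_def q F lessThan_Suc_atMost atLeast0AtMost)
  moreover have "\<Sigma> t X \<le> polar_form Q t X" if "0 \<le> t" "t \<le> T'" for t X
    using pos[of t X] zero[of X] that by (cases "t = 0") auto
  ultimately show ?thesis
    using T' Tc(3) by - (rule exI[of _ T'], rule exI[of _ "c / 2"], simp)
qed

end
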